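(* Let $\mathbf{k}$ be a commutative ring with $1$ and let $\Gamma$ be a finite digraph whose cycles are pairwise disjoint. For each cycle $C$ of $\Gamma$ fix a vertex $v_C$ on $C$, and regard $C$ as the closed path starting and ending at $v_C$ (so $sC=v_C$). Then $$\mathcal{B}:=\{pq^*\mid p,q \text{ paths in }\Gamma,\ tp=tq \text{ is a sink}\}\ \cup\ \{pC^nq^*\mid C \text{ a cycle in }\Gamma,\ p,q\in P_{v_C},\ n\in\mathbb{Z}\}$$ is a $\mathbf{k}$-basis of the Leavitt path algebra $L_{\mathbf{k}}(\Gamma)$, where $C^0:=v_C$ and $C^{-n}:=(C^* )^n$ for $n>0$.
   Context: A digraph $\Gamma=(V,E,s,t)$ has vertex set $V$, arrow set $E$, and source and target maps $s,t:E\to V$ (written $se$, $te$). A vertex $v$ is a sink if $s^{-1}(v)=\emptyset$. A path is either a vertex $v$ (length $0$, $sv=tv=v$) or a sequence $p=e_1\cdots e_n$ of arrows with $te_i=se_{i+1}$, with $sp=se_1$, $tp=te_n$. The internal vertices of $p=e_1\cdots e_n$ are $int(p)=\{se_1,\dots,se_n\}$, and $int(p)=\emptyset$ if $p$ has length $0$. A cycle is a path $C=e_1\cdots e_n$, $n>0$, with $sC=tC$ and $se_i\ne se_j$ for $i\neq j$; cycles differing by cyclic rotation are identified. Cycles are pairwise disjoint if distinct cycles share no vertex. For a vertex $w$, $P_w:=\{p\mid p\text{ a path in }\Gamma,\ tp=w\notin int(p)\}$. Let $E^*=\{e^*\mid e\in E\}$ with $s(e^* )=te$, $t(e^* )=se$.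 The Leavitt path algebra $L_{\mathbf{k}}(\Gamma)$ is the $\mathbf{k}$-algebra generated by $V\sqcup E\sqcup E^*$ with relations: (V) $vw=\delta_{v,w}v$ for $v,w\in V$; (E) $s(e)e=e=e\,t(e)$ for $e\in E\sqcup E^*$; (CK1) $e^*f=\delta_{e,f}\,t(e)$ for $e,f\in E$; (CK2) $v=\sum_{s(e)=v}ee^*$ for every $v$ with $0<|s^{-1}(v)|<\infty$. For a path $p=e_1\cdots e_n$, $p^*:=e_n^*\cdots e_1^*$, and $v^*:=v$ for a vertex $v$. *)

theory Defs
  imports
    "HOL-Algebra.QuotRing"
    "HOL-Algebra.Module"
    "Graph_Theory.Arc_Walk"
begin

definition module_basis ::
    "('k, 'm) ring_scheme \<Rightarrow> ('k, 'b, 'n) module_scheme \<Rightarrow> 'b set \<Rightarrow> bool" where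
  "module_basis R M B \<longleftrightarrow>
     B \<subseteq> carrier M \<and>
     (\<forall>A a. finite A \<and> A \<subseteq> B \<and> a \<in> A \<rightarrow> carrier R \<and>
        (\<Oplus>\<^bsub>M\<^esub>b\<in>A. a b \<odot>\<^bsub>M\<^esub> b) = \<zero>\<^bsub>M\<^esub> \<longrightarrow> (\<forall>b\<in>A. a b = \<zero>\<^bsub>R\<^esub>)) \<and>
     (\<forall>x\<in>carrier M. \<exists>A a. finite A \<and> A \<subseteq> B \<and> a \<in> A \<rightarrow> carrier R \<and>
        x = (\<Oplus>\<^bsub>M\<^esub>b\<in>A. a b \<odot>\<^bsub>M\<^esub> b))"

text \<open>
  The free associative algebra on \<open>X\<close>, without adjoined unit: finitely supported functions on
  the nonempty words over \<open>X\<close>, multiplied by convolution along concatenation. The field \<open>one\<close>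
  of the record is therefore left unspecified.
\<close>

definition free_algebra ::
    "('k, 'm) ring_scheme \<Rightarrow> 'x set \<Rightarrow> ('k, 'x list \<Rightarrow> 'k) module" where
  "free_algebra R X =
     \<lparr> carrier = {f. (\<forall>w. f w \<in> carrier R) \<and> finite {w. f w \<noteq> \<zero>\<^bsub>R\<^esub>} \<and>
                     (\<forall>w. f w \<noteq> \<zero>\<^bsub>R\<^esub> \<longrightarrow> w \<noteq> [] \<and> set w \<subseteq> X)},
       mult = (\<lambda>f g w. \<Oplus>\<^bsub>R\<^esub>i\<in>{..length w}. f (take i w) \<otimes>\<^bsub>R\<^esub> g (drop i w)),
       one = undefined,
       zero = (\<lambda>w. \<zero>\<^bsub>R\<^esub>),
       add = (\<lambda>f g w. f w \<oplus>\<^bsub>R\<^esub> g w),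
       smult = (\<lambda>a f w. a \<otimes>\<^bsub>R\<^esub> f w) \<rparr>"

definition word :: "('k, 'm) ring_scheme \<Rightarrow> 'x list \<Rightarrow> 'x list \<Rightarrow> 'k" where
  "word R w = (\<lambda>u. if u = w then \<one>\<^bsub>R\<^esub> else \<zero>\<^bsub>R\<^esub>)"

text \<open>
  Two-sided ideal of a possibly non-unital algebra generated by \<open>S\<close>. Closure under scalars is
  required explicitly, since scalars need not lie in the algebra.
\<close>

inductive_set algebra_ideal ::
    "('k, 'm) ring_scheme \<Rightarrow> ('k, 'b, 'n) module_scheme \<Rightarrow> 'b set \<Rightarrow> 'b set"
  for R (structure) and A (structure) and S where
  gen: "x \<in> S \<Longrightarrow> x \<in> algebra_ideal R A S"
| zero: "\<zero>\<^bsub>A\<^esub> \<in> algebra_ideal R A S"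
| add: "x \<in> algebra_ideal R A S \<Longrightarrow> y \<in> algebra_ideal R A S \<Longrightarrow> x \<oplus>\<^bsub>A\<^esub> y \<in> algebra_ideal R A S"
| smult: "a \<in> carrier R \<Longrightarrow> x \<in> algebra_ideal R A S \<Longrightarrow> a \<odot>\<^bsub>A\<^esub> x \<in> algebra_ideal R A S"
| mult_left: "y \<in> carrier A \<Longrightarrow> x \<in> algebra_ideal R A S \<Longrightarrow> y \<otimes>\<^bsub>A\<^esub> x \<in> algebra_ideal R A S"
| mult_right: "y \<in> carrier A \<Longrightarrow> x \<in> algebra_ideal R A S \<Longrightarrow> x \<otimes>\<^bsub>A\<^esub> y \<in> algebra_ideal R A S"

text \<open>
  The ring operations are those of the library's quotient ring; only \<open>smult\<close> is added. As for
  \<open>free_algebra\<close>, the field \<open>one\<close> carries no meaning.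
\<close>

definition quotient_algebra :: "('k, 'b, 'n) module_scheme \<Rightarrow> 'b set \<Rightarrow> ('k, 'b set) module" where
  "quotient_algebra A I =
     \<lparr> carrier = carrier (A Quot I),
       mult = mult (A Quot I),
       one = one (A Quot I),
       zero = zero (A Quot I),
       add = add (A Quot I),
       smult = (\<lambda>a Z. \<Union>x\<in>Z. I +>\<^bsub>A\<^esub> (a \<odot>\<^bsub>A\<^esub> x)) \<rparr>"

text \<open>\<open>Ghost e\<close> stands for the formal arrow e* opposite to \<open>e\<close>.\<close>

datatype ('v, 'e) leavitt_gen = Vertex 'v | Arrow 'e | Ghost 'e

definition leavitt_gens :: "('v, 'e) pre_digraph \<Rightarrow> ('v, 'e) leavitt_gen set" where
  "leavitt_gens G = Vertex ` verts G \<union> Arrow ` arcs G \<union> Ghost ` arcs G"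

definition leavitt_free_algebra ::
    "('k, 'm) ring_scheme \<Rightarrow> ('v, 'e) pre_digraph \<Rightarrow> ('k, ('v, 'e) leavitt_gen list \<Rightarrow> 'k) module"
  where "leavitt_free_algebra R G = free_algebra R (leavitt_gens G)"

text \<open>A relation \<open>lhs = rhs\<close> is represented by the element \<open>lhs - rhs\<close> of the free algebra.\<close>

definition leavitt_relations ::
    "('k, 'm) ring_scheme \<Rightarrow> ('v, 'e) pre_digraph \<Rightarrow> (('v, 'e) leavitt_gen list \<Rightarrow> 'k) set" where
  "leavitt_relations R G =
     (let F = leavitt_free_algebra R G;
          vx = (\<lambda>v. word R [Vertex v]);
          ar = (\<lambda>e. word R [Arrow e]);
          gh = (\<lambda>e. word R [Ghost e])
      in
        {(vx v \<otimes>\<^bsub>F\<^esub> vx w) \<ominus>\<^bsub>F\<^esub> (if v = w then vx v else \<zero>\<^bsub>F\<^esub>) |v w.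
            v \<in> verts G \<and> w \<in> verts G} \<union>
        {(vx (tail G e) \<otimes>\<^bsub>F\<^esub> ar e) \<ominus>\<^bsub>F\<^esub> ar e |e. e \<in> arcs G} \<union>
        {(ar e \<otimes>\<^bsub>F\<^esub> vx (head G e)) \<ominus>\<^bsub>F\<^esub> ar e |e. e \<in> arcs G} \<union>
        {(vx (head G e) \<otimes>\<^bsub>F\<^esub> gh e) \<ominus>\<^bsub>F\<^esub> gh e |e. e \<in> arcs G} \<union>
        {(gh e \<otimes>\<^bsub>F\<^esub> vx (tail G e)) \<ominus>\<^bsub>F\<^esub> gh e |e. e \<in> arcs G} \<union>
        {(gh e \<otimes>\<^bsub>F\<^esub> ar f) \<ominus>\<^bsub>F\<^esub> (if e = f then vx (head G e) else \<zero>\<^bsub>F\<^esub>) |e f.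
            e \<in> arcs G \<and> f \<in> arcs G} \<union>
        {vx v \<ominus>\<^bsub>F\<^esub> (\<Oplus>\<^bsub>F\<^esub>e\<in>out_arcs G v. ar e \<otimes>\<^bsub>F\<^esub> gh e) |v.
            v \<in> verts G \<and> finite (out_arcs G v) \<and> out_arcs G v \<noteq> {}})"

definition leavitt_ideal ::
    "('k, 'm) ring_scheme \<Rightarrow> ('v, 'e) pre_digraph \<Rightarrow> (('v, 'e) leavitt_gen list \<Rightarrow> 'k) set" where
  "leavitt_ideal R G = algebra_ideal R (leavitt_free_algebra R G) (leavitt_relations R G)"

definition leavitt_path_algebra ::
    "('k, 'm) ring_scheme \<Rightarrow> ('v, 'e) pre_digraph \<Rightarrow>
      ('k, (('v, 'e) leavitt_gen list \<Rightarrow> 'k) set) module" where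
  "leavitt_path_algebra R G = quotient_algebra (leavitt_free_algebra R G) (leavitt_ideal R G)"

definition leavitt_class ::
    "('k, 'm) ring_scheme \<Rightarrow> ('v, 'e) pre_digraph \<Rightarrow>
      ('v, 'e) leavitt_gen list \<Rightarrow> (('v, 'e) leavitt_gen list \<Rightarrow> 'k) set" where
  "leavitt_class R G w = leavitt_ideal R G +>\<^bsub>leavitt_free_algebra R G\<^esub> word R w"

text \<open>
  A path is a pair of its source and its list of arcs; the source is needed for the paths of
  length 0. The pairs \<open>(u, p)\<close> below are thus exactly the paths with target \<open>w\<close>.
\<close>

definition paths_to :: "('v, 'e) pre_digraph \<Rightarrow> 'v \<Rightarrow> ('v \<times> 'e list) set" where
  "paths_to G w = {(u, p). pre_digraph.awalk G u p w}"

fun internal_verts :: "('v, 'e) pre_digraph \<Rightarrow> 'v \<times> 'e list \<Rightarrow> 'v set" where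
  "internal_verts G (u, p) = tail G ` set p"

definition first_paths_to :: "('v, 'e) pre_digraph \<Rightarrow> 'v \<Rightarrow> ('v \<times> 'e list) set" where
  "first_paths_to G w = {p \<in> paths_to G w. w \<notin> internal_verts G p}"

definition sinks :: "('v, 'e) pre_digraph \<Rightarrow> 'v set" where
  "sinks G = {v \<in> verts G. out_arcs G v = {}}"

fun path_elt ::
    "('k, 'm) ring_scheme \<Rightarrow> ('v, 'e) pre_digraph \<Rightarrow> 'v \<times> 'e list \<Rightarrow>
      (('v, 'e) leavitt_gen list \<Rightarrow> 'k) set" where
  "path_elt R G (u, p) = leavitt_class R G (if p = [] then [Vertex u] else map Arrow p)"

fun ghost_elt ::
    "('k, 'm) ring_scheme \<Rightarrow> ('v, 'e) pre_digraph \<Rightarrow> 'v \<times> 'e list \<Rightarrow>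
      (('v, 'e) leavitt_gen list \<Rightarrow> 'k) set" where
  "ghost_elt R G (u, p) = leavitt_class R G (if p = [] then [Vertex u] else map Ghost (rev p))"

text \<open>
  The power \<open>C\<^sup>n\<close> of a closed path \<open>(v, c)\<close>, where a negative exponent means a positive power
  of \<open>C*\<close>.
\<close>

fun cycle_power ::
    "('k, 'm) ring_scheme \<Rightarrow> ('v, 'e) pre_digraph \<Rightarrow> 'v \<times> 'e list \<Rightarrow> int \<Rightarrow>
      (('v, 'e) leavitt_gen list \<Rightarrow> 'k) set" where
  "cycle_power R G (v, c) n =
     leavitt_class R G
       (if n = 0 then [Vertex v]
        else if n > 0 then concat (replicate (nat n) (map Arrow c))
        else concat (replicate (nat (- n)) (map Ghost (rev c))))"

text \<open>
  Cycles are identified up to rotation: an element of \<open>cycles G\<close> is the set of all rotations of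
  the arc list of a closed path without repeated vertices.
\<close>

definition cycles :: "('v, 'e) pre_digraph \<Rightarrow> 'e list set set" where
  "cycles G = {{rotate n c |n. True} |c. pre_digraph.cycle G c}"

definition cycle_verts :: "('v, 'e) pre_digraph \<Rightarrow> 'e list set \<Rightarrow> 'v set" where
  "cycle_verts G C = (\<Union>c\<in>C. tail G ` set c)"

definition cycles_disjoint :: "('v, 'e) pre_digraph \<Rightarrow> bool" where
  "cycles_disjoint G \<longleftrightarrow>
     (\<forall>C\<in>cycles G. \<forall>D\<in>cycles G. C \<noteq> D \<longrightarrow> cycle_verts G C \<inter> cycle_verts G D = {})"

end

theory Submission
  imports Defs
begin

text \<open>
  Disjointness of the cycles says that at every vertex at most one arc lies on a closed walk
  (\<open>unique_cyclic_arc\<close>): two such arcs with a common tail would start two cycles through that vertex.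
  Consequently a closed walk at the base vertex \<open>b\<close> of a cycle \<open>C\<close> is a power of \<open>C\<close>, and every path
  ending at \<open>b\<close> is \<open>p C^m\<close> with \<open>p\<close> meeting \<open>b\<close> only at its end. Both halves of the proof rest on this.

  Spanning. Words in the generators are zero or monomials \<open>p q*\<close>, where \<open>p\<close> and \<open>q\<close> end at the
  same vertex \<open>x\<close>. By (CK2), \<open>p q*\<close> is the sum of the \<open>(p e)(q e)*\<close> over the arcs \<open>e\<close> leaving \<open>x\<close>. If \<open>e\<close> is
  not cyclic, its head reaches fewer vertices than \<open>x\<close>, which allows induction on the number of
  reachable vertices. If no arc at \<open>x\<close> is cyclic, this settles \<open>p q*\<close>, or \<open>x\<close> is a sink and \<open>p q*\<close> is in
  the basis. Otherwise exactly one arc \<open>e\<close> at \<open>x\<close> is cyclic, and modulo the span \<open>p q*\<close> equals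
  \<open>(p e)(q e)*\<close>. So a monomial can be moved along its cycle in either direction without changing
  whether it is in the span (\<open>monomial_cyclic_walk\<close>). Forwards, it is moved to the base vertex, where it reads
  \<open>p C^m (q C^n)*\<close>; backwards, \<open>min m n\<close> turns of the cycle are cancelled. What remains is a basis element
  (\<open>monomial_at_base_in_span\<close>). Cancelling the turns at once is impossible: \<open>C C*\<close> differs from the vertex \<open>b\<close>
  in general if an arc leaves the cycle.

  Independence. The algebra is represented by partial injections of a set of states. A state is a
  path \<open>p\<close> that meets its endpoint \<open>t\<close>, a sink or a base vertex, only at the end, together with an
  integer \<open>n\<close>; at a base vertex it stands for \<open>p C^n\<close>. The basis element with paths \<open>p\<close>, \<open>q\<close> to \<open>t\<close> and
  exponent \<open>n\<close> sends the state \<open>(q, 0)\<close> to \<open>(p, n)\<close>. Another basis element, with endpoint \<open>t'\<close>, can do the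
  same only if \<open>t'\<close> lies strictly above \<open>t\<close>, that is, \<open>t'\<close> reaches \<open>t\<close> but not conversely
  (\<open>act_basis_word_triangular\<close>). Hence the matrix of these coefficients is triangular with ones on the diagonal with
  respect to the number of vertices that reach the endpoint, and the coefficients in a vanishing
  combination are zero over any commutative ring.
\<close>

section \<open>Non-unital algebras and their quotients\<close>

lemma additive_map_finsum:
  assumes "abelian_monoid G" "abelian_monoid H" "finite A" "f \<in> A \<rightarrow> carrier G"
    and h: "h \<in> carrier G \<rightarrow> carrier H" "h \<zero>\<^bsub>G\<^esub> = \<zero>\<^bsub>H\<^esub>"
    and add: "\<And>x y. x \<in> carrier G \<Longrightarrow> y \<in> carrier G \<Longrightarrow> h (x \<oplus>\<^bsub>G\<^esub> y) = h x \<oplus>\<^bsub>H\<^esub> h y"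
  shows "h (\<Oplus>\<^bsub>G\<^esub>a\<in>A. f a) = (\<Oplus>\<^bsub>H\<^esub>a\<in>A. h (f a))"
proof -
  interpret G: abelian_monoid G by fact
  interpret H: abelian_monoid H by fact
  show ?thesis using assms(3,4)
  proof (induction A)
    case empty show ?case using h by simp
  next
    case (insert x A)
    then have f: "f \<in> A \<rightarrow> carrier G" "f x \<in> carrier G" by auto
    then have "(\<lambda>a. h (f a)) \<in> A \<rightarrow> carrier H" "h (f x) \<in> carrier H" using h by auto
    then show ?case using insert f by (simp add: add)
  qed
qed

text \<open>
  The multiplication of a free algebra without unit, reduced to what the passage to a quotient
  uses: closure and additivity in each argument.
\<close>
locale biadditive_module = Module.module +
  assumes mult_closed [simp]: "x \<in> carrier M \<Longrightarrow> y \<in> carrier M \<Longrightarrow> x \<otimes>\<^bsub>M\<^esub> y \<in> carrier M"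
    and mult_distr_left: "x \<in> carrier M \<Longrightarrow> y \<in> carrier M \<Longrightarrow> z \<in> carrier M \<Longrightarrow>
      (x \<oplus>\<^bsub>M\<^esub> y) \<otimes>\<^bsub>M\<^esub> z = x \<otimes>\<^bsub>M\<^esub> z \<oplus>\<^bsub>M\<^esub> y \<otimes>\<^bsub>M\<^esub> z"
    and mult_distr_right: "x \<in> carrier M \<Longrightarrow> y \<in> carrier M \<Longrightarrow> z \<in> carrier M \<Longrightarrow>
      z \<otimes>\<^bsub>M\<^esub> (x \<oplus>\<^bsub>M\<^esub> y) = z \<otimes>\<^bsub>M\<^esub> x \<oplus>\<^bsub>M\<^esub> z \<otimes>\<^bsub>M\<^esub> y"

locale presented_algebra = biadditive_module +
  fixes S
  assumes relations_closed: "S \<subseteq> carrier M"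
begin

abbreviation I where "I \<equiv> algebra_ideal R M S"
abbreviation Q where "Q \<equiv> quotient_algebra M I"
abbreviation cls where "cls x \<equiv> I +>\<^bsub>M\<^esub> x"

lemma ideal_closed: "x \<in> I \<Longrightarrow> x \<in> carrier M"
  by (induction rule: algebra_ideal.induct) (use relations_closed in auto)

lemma ideal_subgroup: "abelian_subgroup I M"
proof -
  have "\<ominus>\<^bsub>M\<^esub> x \<in> I" if "x \<in> I" for x
  proof -
    have "\<ominus>\<^bsub>M\<^esub> x = (\<ominus>\<^bsub>R\<^esub> \<one>\<^bsub>R\<^esub>) \<odot>\<^bsub>M\<^esub> x"
      using ideal_closed[OF that] by (simp add: smult_l_minus)
    then show ?thesis using that by (auto intro: algebra_ideal.smult)
  qed
  then have "subgroup I (add_monoid M)"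
    by (intro subgroup.intro)
      (auto intro: algebra_ideal.intros ideal_closed simp flip: a_inv_def)
  then show ?thesis
    using abelian_subgroupI2 M.a_comm_group by blast
qed

sublocale I: abelian_subgroup I M by (rule ideal_subgroup)

lemma cls_eq_iff:
  assumes "x \<in> carrier M" "y \<in> carrier M"
  shows "cls x = cls y \<longleftrightarrow> x \<ominus>\<^bsub>M\<^esub> y \<in> I"
  using I.a_rcos_module[of y x] I.a_repr_independence'[of x y] I.a_repr_independenceD[of x y] assms
  by (metis a_minus_def)

lemma cls_closed [simp]: "x \<in> carrier M \<Longrightarrow> cls x \<in> carrier Q"
  by (auto simp: quotient_algebra_def FactRing_def A_RCOSETS_def')

lemma carrier_quotient: "carrier Q = cls ` carrier M"
  by (auto simp: quotient_algebra_def FactRing_def A_RCOSETS_def')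

lemma cls_eqI:
  assumes "x \<in> cls y" "y \<in> carrier M"
  shows "cls x = cls y"
  using I.a_repr_independence'[OF assms] by simp

lemma cls_add:
  "x \<in> carrier M \<Longrightarrow> y \<in> carrier M \<Longrightarrow> cls x \<oplus>\<^bsub>Q\<^esub> cls y = cls (x \<oplus>\<^bsub>M\<^esub> y)"
  by (simp add: quotient_algebra_def FactRing_def I.a_rcos_sum)

lemma cls_zero: "cls \<zero>\<^bsub>M\<^esub> = \<zero>\<^bsub>Q\<^esub>"
  using I.a_rcos_const[of "\<zero>\<^bsub>M\<^esub>"] by (simp add: quotient_algebra_def FactRing_def)

lemma cls_zero_iff: "x \<in> carrier M \<Longrightarrow> cls x = \<zero>\<^bsub>Q\<^esub> \<longleftrightarrow> x \<in> I"
  using I.a_rcos_self[of x] I.a_rcos_const[of x]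
  by (auto simp: quotient_algebra_def FactRing_def)

lemma cls_smult:
  assumes "a \<in> carrier R" "x \<in> carrier M"
  shows "a \<odot>\<^bsub>Q\<^esub> cls x = cls (a \<odot>\<^bsub>M\<^esub> x)"
proof -
  have "cls (a \<odot>\<^bsub>M\<^esub> y) = cls (a \<odot>\<^bsub>M\<^esub> x)" if "y \<in> cls x" for y
  proof -
    have y: "y \<in> carrier M" using I.a_elemrcos_carrier that assms by blast
    have "y \<ominus>\<^bsub>M\<^esub> x \<in> I"
      using cls_eqI[OF that] cls_eq_iff assms y by blast
    then have "a \<odot>\<^bsub>M\<^esub> (y \<ominus>\<^bsub>M\<^esub> x) \<in> I"
      using assms by (auto intro: algebra_ideal.smult)
    then have "a \<odot>\<^bsub>M\<^esub> y \<ominus>\<^bsub>M\<^esub> a \<odot>\<^bsub>M\<^esub> x \<in> I"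
      using assms y by (simp add: a_minus_def smult_r_distr smult_r_minus)
    then show ?thesis using assms y cls_eq_iff by simp
  qed
  moreover have "x \<in> cls x" using assms I.a_rcos_self by blast
  ultimately have "(\<Union>y\<in>cls x. cls (a \<odot>\<^bsub>M\<^esub> y)) = cls (a \<odot>\<^bsub>M\<^esub> x)" by blast
  then show ?thesis by (simp add: quotient_algebra_def)
qed

lemma mult_uminus:
  assumes "x \<in> carrier M" "y \<in> carrier M"
  shows "(\<ominus>\<^bsub>M\<^esub> x) \<otimes>\<^bsub>M\<^esub> y = \<ominus>\<^bsub>M\<^esub> (x \<otimes>\<^bsub>M\<^esub> y)" "x \<otimes>\<^bsub>M\<^esub> (\<ominus>\<^bsub>M\<^esub> y) = \<ominus>\<^bsub>M\<^esub> (x \<otimes>\<^bsub>M\<^esub> y)"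
proof -
  have zl: "\<zero>\<^bsub>M\<^esub> \<otimes>\<^bsub>M\<^esub> y = \<zero>\<^bsub>M\<^esub>"
    using mult_distr_left[of "\<zero>\<^bsub>M\<^esub>" "\<zero>\<^bsub>M\<^esub>" y] assms by simp
  have zr: "x \<otimes>\<^bsub>M\<^esub> \<zero>\<^bsub>M\<^esub> = \<zero>\<^bsub>M\<^esub>"
    using mult_distr_right[of "\<zero>\<^bsub>M\<^esub>" "\<zero>\<^bsub>M\<^esub>" x] assms by simp
  have "(\<ominus>\<^bsub>M\<^esub> x) \<otimes>\<^bsub>M\<^esub> y \<oplus>\<^bsub>M\<^esub> x \<otimes>\<^bsub>M\<^esub> y = \<zero>\<^bsub>M\<^esub>"
    using assms mult_distr_left[of "\<ominus>\<^bsub>M\<^esub> x" x y] zl by (simp add: M.l_neg)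
  then show "(\<ominus>\<^bsub>M\<^esub> x) \<otimes>\<^bsub>M\<^esub> y = \<ominus>\<^bsub>M\<^esub> (x \<otimes>\<^bsub>M\<^esub> y)"
    using assms by (simp add: M.minus_equality)
  have "x \<otimes>\<^bsub>M\<^esub> (\<ominus>\<^bsub>M\<^esub> y) \<oplus>\<^bsub>M\<^esub> x \<otimes>\<^bsub>M\<^esub> y = \<zero>\<^bsub>M\<^esub>"
    using assms mult_distr_right[of "\<ominus>\<^bsub>M\<^esub> y" y x] zr by (simp add: M.l_neg)
  then show "x \<otimes>\<^bsub>M\<^esub> (\<ominus>\<^bsub>M\<^esub> y) = \<ominus>\<^bsub>M\<^esub> (x \<otimes>\<^bsub>M\<^esub> y)"
    using assms by (simp add: M.minus_equality)
qed

text \<open>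
  Well-definedness is the usual decomposition
  \<open>x' y' - x y = (x' - x) y' + x (y' - y)\<close>, whose summands lie in the two-sided ideal.
\<close>
lemma cls_mult:
  assumes "x \<in> carrier M" "y \<in> carrier M"
  shows "cls x \<otimes>\<^bsub>Q\<^esub> cls y = cls (x \<otimes>\<^bsub>M\<^esub> y)"
proof -
  have "cls (x' \<otimes>\<^bsub>M\<^esub> y') = cls (x \<otimes>\<^bsub>M\<^esub> y)" if "x' \<in> cls x" "y' \<in> cls y" for x' y'
  proof -
    have c: "x' \<in> carrier M" "y' \<in> carrier M"
      using I.a_elemrcos_carrier that assms by blast+
    have "x' \<ominus>\<^bsub>M\<^esub> x \<in> I" "y' \<ominus>\<^bsub>M\<^esub> y \<in> I"
      using cls_eqI[OF that(1)] cls_eqI[OF that(2)] cls_eq_iff assms c by auto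
    then have "(x' \<ominus>\<^bsub>M\<^esub> x) \<otimes>\<^bsub>M\<^esub> y' \<in> I" "x \<otimes>\<^bsub>M\<^esub> (y' \<ominus>\<^bsub>M\<^esub> y) \<in> I"
      using assms c by (auto intro: algebra_ideal.intros)
    then have "x' \<otimes>\<^bsub>M\<^esub> y' \<ominus>\<^bsub>M\<^esub> x \<otimes>\<^bsub>M\<^esub> y' \<in> I" "x \<otimes>\<^bsub>M\<^esub> y' \<ominus>\<^bsub>M\<^esub> x \<otimes>\<^bsub>M\<^esub> y \<in> I"
      using assms c by (simp_all add: a_minus_def mult_distr_left mult_distr_right mult_uminus)
    then show ?thesis using assms c cls_eq_iff by (metis mult_closed)
  qed
  moreover have "x \<in> cls x" "y \<in> cls y" using assms I.a_rcos_self by auto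
  ultimately have "(\<Union>x'\<in>cls x. \<Union>y'\<in>cls y. cls (x' \<otimes>\<^bsub>M\<^esub> y')) = cls (x \<otimes>\<^bsub>M\<^esub> y)" by blast
  then show ?thesis
    by (simp add: quotient_algebra_def FactRing_def rcoset_mult_def)
qed

lemma quotient_abelian_group: "abelian_group Q"
proof (rule abelian_groupI)
  fix X assume "X \<in> carrier Q"
  then obtain x where x: "x \<in> carrier M" "X = cls x" by (auto simp: carrier_quotient)
  then have "cls (\<ominus>\<^bsub>M\<^esub> x) \<oplus>\<^bsub>Q\<^esub> X = \<zero>\<^bsub>Q\<^esub>"
    by (simp add: cls_add M.l_neg cls_zero)
  then show "\<exists>Y\<in>carrier Q. Y \<oplus>\<^bsub>Q\<^esub> X = \<zero>\<^bsub>Q\<^esub>" using x by auto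
qed (auto simp: carrier_quotient cls_add M.a_ac simp flip: cls_zero)

lemma cls_finsum:
  assumes "finite A" "f \<in> A \<rightarrow> carrier M"
  shows "cls (\<Oplus>\<^bsub>M\<^esub>x\<in>A. f x) = (\<Oplus>\<^bsub>Q\<^esub>x\<in>A. cls (f x))"
  using M.abelian_monoid_axioms abelian_group.axioms(1)[OF quotient_abelian_group] assms
  by (rule additive_map_finsum[where h = cls]) (simp_all add: cls_zero cls_add)

lemma quotient_biadditive_module: "biadditive_module R Q"
proof -
  interpret Q: abelian_group Q by (rule quotient_abelian_group)
  have "Module.module R Q"
    by (rule moduleI)
      (auto simp: carrier_quotient cls_smult cls_add smult_l_distr smult_r_distr smult_assoc1
        R.is_cring quotient_abelian_group)
  then show ?thesis
    by (intro biadditive_module.intro biadditive_module_axioms.intro)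
      (auto simp: carrier_quotient cls_mult cls_add mult_distr_left mult_distr_right)
qed

end

section \<open>Linear span\<close>

definition linear_span ::
    "('k, 'm) ring_scheme \<Rightarrow> ('k, 'b, 'n) module_scheme \<Rightarrow> 'b set \<Rightarrow> 'b set" where
  "linear_span R M B =
     {x. \<exists>A a. finite A \<and> A \<subseteq> B \<and> a \<in> A \<rightarrow> carrier R \<and> x = (\<Oplus>\<^bsub>M\<^esub>b\<in>A. a b \<odot>\<^bsub>M\<^esub> b)}"

context Module.module
begin

lemma linear_span_closed:
  assumes "B \<subseteq> carrier M" "x \<in> linear_span R M B"
  shows "x \<in> carrier M"
  using assms by (force simp: linear_span_def Pi_iff intro!: M.finsum_closed)

lemma linear_span_superset:
  assumes "B \<subseteq> carrier M" "b \<in> B"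
  shows "b \<in> linear_span R M B"
proof -
  have "b = (\<Oplus>\<^bsub>M\<^esub>b\<in>{b}. \<one>\<^bsub>R\<^esub> \<odot>\<^bsub>M\<^esub> b)" using assms by (subst M.finsum_insert) auto
  then show ?thesis
    unfolding linear_span_def using assms(2) by (intro CollectI exI[of _ "{b}"] exI[of _ "\<lambda>_. \<one>\<^bsub>R\<^esub>"]) auto
qed

lemma linear_span_zero: "\<zero>\<^bsub>M\<^esub> \<in> linear_span R M B"
  unfolding linear_span_def by (intro CollectI exI[of _ "{}"]) auto

lemma linear_span_smult:
  assumes "B \<subseteq> carrier M" "k \<in> carrier R" "x \<in> linear_span R M B"
  shows "k \<odot>\<^bsub>M\<^esub> x \<in> linear_span R M B"
proof -
  obtain A a where A: "finite A" "A \<subseteq> B" "a \<in> A \<rightarrow> carrier R" "x = (\<Oplus>\<^bsub>M\<^esub>b\<in>A. a b \<odot>\<^bsub>M\<^esub> b)"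
    using assms(3) by (auto simp: linear_span_def)
  have c: "b \<in> carrier M" "a b \<in> carrier R" if "b \<in> A" for b using that A assms(1) by auto
  have "k \<odot>\<^bsub>M\<^esub> x = (\<Oplus>\<^bsub>M\<^esub>b\<in>A. k \<odot>\<^bsub>M\<^esub> (a b \<odot>\<^bsub>M\<^esub> b))"
    unfolding A(4) using A(1) assms(2) c by (intro finsum_smult_ldistr) auto
  also have "\<dots> = (\<Oplus>\<^bsub>M\<^esub>b\<in>A. (k \<otimes>\<^bsub>R\<^esub> a b) \<odot>\<^bsub>M\<^esub> b)"
    using assms(2) c by (intro M.finsum_cong') (auto simp: smult_assoc1)
  finally show ?thesis
    unfolding linear_span_def using A assms(2) c
    by (intro CollectI exI[of _ A] exI[of _ "\<lambda>b. k \<otimes>\<^bsub>R\<^esub> a b"]) auto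
qed

lemma linear_span_add:
  assumes "B \<subseteq> carrier M" "x \<in> linear_span R M B" "y \<in> linear_span R M B"
  shows "x \<oplus>\<^bsub>M\<^esub> y \<in> linear_span R M B"
proof -
  obtain A a where A: "finite A" "A \<subseteq> B" "a \<in> A \<rightarrow> carrier R" "x = (\<Oplus>\<^bsub>M\<^esub>b\<in>A. a b \<odot>\<^bsub>M\<^esub> b)"
    using assms(2) by (auto simp: linear_span_def)
  obtain A' a' where A': "finite A'" "A' \<subseteq> B" "a' \<in> A' \<rightarrow> carrier R" "y = (\<Oplus>\<^bsub>M\<^esub>b\<in>A'. a' b \<odot>\<^bsub>M\<^esub> b)"
    using assms(3) by (auto simp: linear_span_def)
  define f where "f b = (if b \<in> A then a b else \<zero>\<^bsub>R\<^esub>)" for b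
  define f' where "f' b = (if b \<in> A' then a' b else \<zero>\<^bsub>R\<^esub>)" for b
  have c: "b \<in> carrier M" if "b \<in> A \<union> A'" for b using that A A' assms(1) by auto
  have f: "f b \<in> carrier R" "f' b \<in> carrier R" for b
    using A(3) A'(3) by (auto simp: f_def f'_def)
  have "x = (\<Oplus>\<^bsub>M\<^esub>b\<in>A \<union> A'. f b \<odot>\<^bsub>M\<^esub> b)" unfolding A(4)
    by (rule M.add.finprod_mono_neutral_cong_left)
      (use A(1) A'(1) c f in \<open>auto simp: f_def\<close>)
  moreover have "y = (\<Oplus>\<^bsub>M\<^esub>b\<in>A \<union> A'. f' b \<odot>\<^bsub>M\<^esub> b)" unfolding A'(4)
    by (rule M.add.finprod_mono_neutral_cong_left)
      (use A(1) A'(1) c f in \<open>auto simp: f'_def\<close>)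
  moreover have "(\<Oplus>\<^bsub>M\<^esub>b\<in>A \<union> A'. f b \<odot>\<^bsub>M\<^esub> b) \<oplus>\<^bsub>M\<^esub> (\<Oplus>\<^bsub>M\<^esub>b\<in>A \<union> A'. f' b \<odot>\<^bsub>M\<^esub> b)
      = (\<Oplus>\<^bsub>M\<^esub>b\<in>A \<union> A'. f b \<odot>\<^bsub>M\<^esub> b \<oplus>\<^bsub>M\<^esub> f' b \<odot>\<^bsub>M\<^esub> b)"
    using c f by (intro M.finsum_addf[symmetric]) auto
  moreover have "\<dots> = (\<Oplus>\<^bsub>M\<^esub>b\<in>A \<union> A'. (f b \<oplus>\<^bsub>R\<^esub> f' b) \<odot>\<^bsub>M\<^esub> b)"
    using c f by (intro M.finsum_cong') (auto simp: smult_l_distr)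
  ultimately have "x \<oplus>\<^bsub>M\<^esub> y = (\<Oplus>\<^bsub>M\<^esub>b\<in>A \<union> A'. (f b \<oplus>\<^bsub>R\<^esub> f' b) \<odot>\<^bsub>M\<^esub> b)" by simp
  then show ?thesis
    unfolding linear_span_def using A A' f
    by (intro CollectI exI[of _ "A \<union> A'"] exI[of _ "\<lambda>b. f b \<oplus>\<^bsub>R\<^esub> f' b"]) auto
qed

lemma linear_span_finsum:
  assumes "B \<subseteq> carrier M" "finite A" "\<And>x. x \<in> A \<Longrightarrow> f x \<in> linear_span R M B"
  shows "(\<Oplus>\<^bsub>M\<^esub>x\<in>A. f x) \<in> linear_span R M B"
  using assms(2,3)
proof (induction A)
  case empty
  then show ?case by (simp add: linear_span_zero)
next
  case (insert x A)
  then have "f \<in> A \<rightarrow> carrier M" "f x \<in> carrier M" using linear_span_closed[OF assms(1)] by auto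
  then show ?case using insert linear_span_add[OF assms(1)] by simp
qed

text \<open>
  This is what it means to compute modulo the span: an element may be changed by an element of the span.
\<close>
lemma linear_span_add_cancel:
  assumes "B \<subseteq> carrier M" "x \<in> carrier M" "y \<in> linear_span R M B"
  shows "x \<oplus>\<^bsub>M\<^esub> y \<in> linear_span R M B \<longleftrightarrow> x \<in> linear_span R M B"
proof
  assume xy: "x \<oplus>\<^bsub>M\<^esub> y \<in> linear_span R M B"
  have y: "y \<in> carrier M" using linear_span_closed assms by blast
  have "(\<ominus>\<^bsub>R\<^esub> \<one>\<^bsub>R\<^esub>) \<odot>\<^bsub>M\<^esub> y \<in> linear_span R M B"
    using linear_span_smult assms by simp
  then have "(x \<oplus>\<^bsub>M\<^esub> y) \<oplus>\<^bsub>M\<^esub> (\<ominus>\<^bsub>R\<^esub> \<one>\<^bsub>R\<^esub>) \<odot>\<^bsub>M\<^esub> y \<in> linear_span R M B"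
    using linear_span_add assms(1) xy by blast
  moreover have "(x \<oplus>\<^bsub>M\<^esub> y) \<oplus>\<^bsub>M\<^esub> (\<ominus>\<^bsub>R\<^esub> \<one>\<^bsub>R\<^esub>) \<odot>\<^bsub>M\<^esub> y = x"
    using assms(2) y by (simp add: smult_l_minus M.a_assoc M.r_neg)
  ultimately show "x \<in> linear_span R M B" by simp
qed (use assms linear_span_add in blast)

end

section \<open>The free algebra\<close>

lemma in_free_algebra:
  "f \<in> carrier (free_algebra R X) \<longleftrightarrow>
    (\<forall>w. f w \<in> carrier R) \<and> finite {w. f w \<noteq> \<zero>\<^bsub>R\<^esub>} \<and>
    (\<forall>w. f w \<noteq> \<zero>\<^bsub>R\<^esub> \<longrightarrow> w \<noteq> [] \<and> set w \<subseteq> X)"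
  by (simp add: free_algebra_def)

lemma free_algebra_apply [simp]:
  "(f \<oplus>\<^bsub>free_algebra R X\<^esub> g) w = f w \<oplus>\<^bsub>R\<^esub> g w"
  "(a \<odot>\<^bsub>free_algebra R X\<^esub> f) w = a \<otimes>\<^bsub>R\<^esub> f w"
  "\<zero>\<^bsub>free_algebra R X\<^esub> w = \<zero>\<^bsub>R\<^esub>"
  "(f \<otimes>\<^bsub>free_algebra R X\<^esub> g) w =
    (\<Oplus>\<^bsub>R\<^esub>i\<in>{..length w}. f (take i w) \<otimes>\<^bsub>R\<^esub> g (drop i w))"
  by (simp_all add: free_algebra_def)

text \<open>
  The linear extension to the free algebra of a function \<open>\<psi>\<close> on words.
\<close>
definition pairing :: "('k, 'm) ring_scheme \<Rightarrow> ('x list \<Rightarrow> 'k) \<Rightarrow> ('x list \<Rightarrow> 'k) \<Rightarrow> 'k" where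
  "pairing R \<psi> f = (\<Oplus>\<^bsub>R\<^esub>w\<in>{w. f w \<noteq> \<zero>\<^bsub>R\<^esub>}. f w \<otimes>\<^bsub>R\<^esub> \<psi> w)"

context cring
begin

lemma free_algebra_closed:
  assumes "f \<in> carrier (free_algebra R X)"
  shows "f w \<in> carrier R"
  using assms by (simp add: in_free_algebra)

lemma free_algebra_zero_closed: "\<zero>\<^bsub>free_algebra R X\<^esub> \<in> carrier (free_algebra R X)"
  by (simp add: in_free_algebra)

lemma free_algebra_add_closed:
  assumes "f \<in> carrier (free_algebra R X)" "g \<in> carrier (free_algebra R X)"
  shows "f \<oplus>\<^bsub>free_algebra R X\<^esub> g \<in> carrier (free_algebra R X)"
proof -
  have "{w. f w \<oplus> g w \<noteq> \<zero>} \<subseteq> {w. f w \<noteq> \<zero>} \<union> {w. g w \<noteq> \<zero>}" by auto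
  then have "finite {w. f w \<oplus> g w \<noteq> \<zero>}"
    using assms by (auto simp: in_free_algebra intro: finite_subset)
  moreover have "w \<noteq> [] \<and> set w \<subseteq> X" if "f w \<oplus> g w \<noteq> \<zero>" for w
    using assms that unfolding in_free_algebra by (metis l_zero zero_closed)
  ultimately show ?thesis using assms by (simp add: in_free_algebra)
qed

lemma free_algebra_smult_closed:
  assumes "a \<in> carrier R" "f \<in> carrier (free_algebra R X)"
  shows "a \<odot>\<^bsub>free_algebra R X\<^esub> f \<in> carrier (free_algebra R X)"
proof -
  have "{w. a \<otimes> f w \<noteq> \<zero>} \<subseteq> {w. f w \<noteq> \<zero>}" using assms by auto
  then have "finite {w. a \<otimes> f w \<noteq> \<zero>}"
    using assms by (auto simp: in_free_algebra intro: finite_subset)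
  moreover have "w \<noteq> [] \<and> set w \<subseteq> X" if "a \<otimes> f w \<noteq> \<zero>" for w
    using assms that unfolding in_free_algebra by (metis r_null)
  ultimately show ?thesis using assms by (simp add: in_free_algebra)
qed

lemma word_closed:
  assumes "w \<noteq> []" "set w \<subseteq> X"
  shows "word R w \<in> carrier (free_algebra R X)"
proof -
  have "{u. word R w u \<noteq> \<zero>} \<subseteq> {w}" by (auto simp: word_def)
  then have "finite {u. word R w u \<noteq> \<zero>}" by (rule finite_subset) simp
  then show ?thesis using assms by (auto simp: in_free_algebra word_def)
qed

lemma free_algebra_mult_closed:
  assumes f: "f \<in> carrier (free_algebra R X)" and g: "g \<in> carrier (free_algebra R X)"
  shows "f \<otimes>\<^bsub>free_algebra R X\<^esub> g \<in> carrier (free_algebra R X)"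
proof -
  let ?fg = "f \<otimes>\<^bsub>free_algebra R X\<^esub> g"
  have c: "?fg w \<in> carrier R" for w
    using f g by (auto simp: free_algebra_closed intro!: finsum_closed)
  have split: "\<exists>u v. w = u @ v \<and> f u \<noteq> \<zero> \<and> g v \<noteq> \<zero>" if "?fg w \<noteq> \<zero>" for w
  proof (rule ccontr)
    assume *: "\<not> ?thesis"
    have "f (take i w) \<otimes> g (drop i w) = \<zero>" for i
    proof -
      have "f (take i w) = \<zero> \<or> g (drop i w) = \<zero>"
        using * append_take_drop_id[of i w] by metis
      then show ?thesis using f g by (auto simp: free_algebra_closed)
    qed
    then have "?fg w = \<zero>" by simp
    with that show False by simp
  qed
  have "{w. ?fg w \<noteq> \<zero>} \<subseteq> (\<lambda>(u, v). u @ v) ` ({u. f u \<noteq> \<zero>} \<times> {v. g v \<noteq> \<zero>})"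
    using split by fast
  then have "finite {w. ?fg w \<noteq> \<zero>}"
    by (rule finite_subset) (use f g in \<open>simp add: in_free_algebra\<close>)
  moreover have "w \<noteq> [] \<and> set w \<subseteq> X" if fgw: "?fg w \<noteq> \<zero>" for w
  proof -
    obtain u v where "w = u @ v" "f u \<noteq> \<zero>" "g v \<noteq> \<zero>" using split[OF fgw] by blast
    then show ?thesis using f g unfolding in_free_algebra by auto
  qed
  ultimately show ?thesis using c unfolding in_free_algebra by blast
qed

lemma free_algebra_module: "Module.module R (free_algebra R X)"
proof (rule moduleI)
  show "abelian_group (free_algebra R X)"
  proof (rule abelian_groupI)
    fix f assume f: "f \<in> carrier (free_algebra R X)"
    then have "((\<ominus> \<one>) \<odot>\<^bsub>free_algebra R X\<^esub> f) \<oplus>\<^bsub>free_algebra R X\<^esub> f = \<zero>\<^bsub>free_algebra R X\<^esub>"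
      by (auto simp: fun_eq_iff free_algebra_closed l_minus l_neg)
    then show "\<exists>g\<in>carrier (free_algebra R X). g \<oplus>\<^bsub>free_algebra R X\<^esub> f = \<zero>\<^bsub>free_algebra R X\<^esub>"
      using free_algebra_smult_closed[OF _ f, of "\<ominus> \<one>"] by auto
  qed (auto simp: free_algebra_add_closed free_algebra_zero_closed free_algebra_closed a_ac
        fun_eq_iff)
qed (auto simp: free_algebra_add_closed free_algebra_smult_closed free_algebra_closed
    fun_eq_iff l_distr r_distr m_assoc is_cring)

lemma free_algebra_biadditive: "biadditive_module R (free_algebra R X)"
proof (intro biadditive_module.intro biadditive_module_axioms.intro free_algebra_module
      free_algebra_mult_closed)
  fix f g h :: "'c list \<Rightarrow> 'a"
  assume "f \<in> carrier (free_algebra R X)" "g \<in> carrier (free_algebra R X)"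
    "h \<in> carrier (free_algebra R X)"
  then have c: "f w \<in> carrier R" "g w \<in> carrier R" "h w \<in> carrier R" for w
    by (simp_all add: free_algebra_closed)
  have cong: "(\<Oplus>i\<in>{..length w}. (f (take i w) \<oplus> g (take i w)) \<otimes> h (drop i w)) =
      (\<Oplus>i\<in>{..length w}. f (take i w) \<otimes> h (drop i w) \<oplus> g (take i w) \<otimes> h (drop i w))" for w
    using c by (intro finsum_cong') (auto simp: l_distr)
  have sum: "(\<Oplus>i\<in>{..length w}. f (take i w) \<otimes> h (drop i w) \<oplus> g (take i w) \<otimes> h (drop i w)) = (\<Oplus>i\<in>{..length w}. f (take i w) \<otimes> h (drop i w)) \<oplus>
      (\<Oplus>i\<in>{..length w}. g (take i w) \<otimes> h (drop i w))" for w
    using c by (intro finsum_addf) auto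
  show "(f \<oplus>\<^bsub>free_algebra R X\<^esub> g) \<otimes>\<^bsub>free_algebra R X\<^esub> h =
      f \<otimes>\<^bsub>free_algebra R X\<^esub> h \<oplus>\<^bsub>free_algebra R X\<^esub> g \<otimes>\<^bsub>free_algebra R X\<^esub> h"
    by (simp add: fun_eq_iff cong sum)
  have cong: "(\<Oplus>i\<in>{..length w}. h (take i w) \<otimes> (f (drop i w) \<oplus> g (drop i w))) =
      (\<Oplus>i\<in>{..length w}. h (take i w) \<otimes> f (drop i w) \<oplus> h (take i w) \<otimes> g (drop i w))" for w
    using c by (intro finsum_cong') (auto simp: r_distr)
  have sum: "(\<Oplus>i\<in>{..length w}. h (take i w) \<otimes> f (drop i w) \<oplus> h (take i w) \<otimes> g (drop i w)) = (\<Oplus>i\<in>{..length w}. h (take i w) \<otimes> f (drop i w)) \<oplus>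
      (\<Oplus>i\<in>{..length w}. h (take i w) \<otimes> g (drop i w))" for w
    using c by (intro finsum_addf) auto
  show "h \<otimes>\<^bsub>free_algebra R X\<^esub> (f \<oplus>\<^bsub>free_algebra R X\<^esub> g) =
      h \<otimes>\<^bsub>free_algebra R X\<^esub> f \<oplus>\<^bsub>free_algebra R X\<^esub> h \<otimes>\<^bsub>free_algebra R X\<^esub> g"
    by (simp add: fun_eq_iff cong sum)
qed

lemma free_algebra_smult_mult:
  assumes "a \<in> carrier R" "f \<in> carrier (free_algebra R X)" "g \<in> carrier (free_algebra R X)"
  shows "(a \<odot>\<^bsub>free_algebra R X\<^esub> f) \<otimes>\<^bsub>free_algebra R X\<^esub> g =
      a \<odot>\<^bsub>free_algebra R X\<^esub> (f \<otimes>\<^bsub>free_algebra R X\<^esub> g)"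
    and "f \<otimes>\<^bsub>free_algebra R X\<^esub> (a \<odot>\<^bsub>free_algebra R X\<^esub> g) =
      a \<odot>\<^bsub>free_algebra R X\<^esub> (f \<otimes>\<^bsub>free_algebra R X\<^esub> g)"
proof -
  have c: "f w \<in> carrier R" "g w \<in> carrier R" for w
    using assms by (auto simp: free_algebra_closed)
  have rdistr: "a \<otimes> (\<Oplus>i\<in>{..length w}. f (take i w) \<otimes> g (drop i w)) =
      (\<Oplus>i\<in>{..length w}. a \<otimes> (f (take i w) \<otimes> g (drop i w)))" for w
    using assms(1) c by (intro finsum_rdistr) auto
  show "(a \<odot>\<^bsub>free_algebra R X\<^esub> f) \<otimes>\<^bsub>free_algebra R X\<^esub> g =
      a \<odot>\<^bsub>free_algebra R X\<^esub> (f \<otimes>\<^bsub>free_algebra R X\<^esub> g)"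
    unfolding fun_eq_iff free_algebra_apply rdistr
    using assms(1) c by (intro allI finsum_cong') (auto simp: m_assoc)
  show "f \<otimes>\<^bsub>free_algebra R X\<^esub> (a \<odot>\<^bsub>free_algebra R X\<^esub> g) =
      a \<odot>\<^bsub>free_algebra R X\<^esub> (f \<otimes>\<^bsub>free_algebra R X\<^esub> g)"
    unfolding fun_eq_iff free_algebra_apply rdistr
    using assms(1) c by (intro allI finsum_cong') (auto simp: m_lcomm)
qed

lemma word_mult: "word R u \<otimes>\<^bsub>free_algebra R X\<^esub> word R v = word R (u @ v)"
proof
  fix w
  define c where "c = word R (u @ v) w"
  have c: "c \<in> carrier R" by (simp add: c_def word_def)
  have eq: "word R u (take i w) \<otimes> word R v (drop i w) = (if i = length u then c else \<zero>)"
    if "i \<le> length w" for i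
  proof (cases "take i w = u \<and> drop i w = v")
    case True
    then have "w = u @ v" "i = length u" using that by auto
    then show ?thesis by (simp add: word_def c_def)
  next
    case False
    then have "word R u (take i w) \<otimes> word R v (drop i w) = \<zero>" by (auto simp: word_def)
    moreover have "c = \<zero>" if "i = length u"
    proof -
      have "w \<noteq> u @ v" using False that by auto
      then show ?thesis by (simp add: c_def word_def)
    qed
    ultimately show ?thesis by simp
  qed
  have "(word R u \<otimes>\<^bsub>free_algebra R X\<^esub> word R v) w =
      (\<Oplus>i\<in>{..length w}. if i = length u then c else \<zero>)"
    unfolding free_algebra_apply using c by (intro finsum_cong') (simp_all add: eq)
  also have "\<dots> = c"
  proof (cases "length u \<le> length w")
    case True
    then show ?thesis
      using add.finprod_singleton_swap[of "length u" "{..length w}" "\<lambda>_. c"] c by simp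
  next
    case False
    then have "c = \<zero>" by (auto simp: c_def word_def)
    then show ?thesis by (subst add.finprod_one_eqI) auto
  qed
  finally show "(word R u \<otimes>\<^bsub>free_algebra R X\<^esub> word R v) w = word R (u @ v) w"
    by (simp only: c_def)
qed

text \<open>
  Identities that are additive in an element of the free algebra need only be checked on scalar
  multiples of words. This replaces manipulations of the convolution sum.
\<close>
lemma free_algebra_induct [consumes 1, case_names zero add]:
  assumes "f \<in> carrier (free_algebra R X)"
    and zero: "P \<zero>\<^bsub>free_algebra R X\<^esub>"
    and add: "\<And>a w f. a \<in> carrier R \<Longrightarrow> w \<noteq> [] \<Longrightarrow> set w \<subseteq> X \<Longrightarrow>
      f \<in> carrier (free_algebra R X) \<Longrightarrow> P f \<Longrightarrow>
      P (f \<oplus>\<^bsub>free_algebra R X\<^esub> a \<odot>\<^bsub>free_algebra R X\<^esub> word R w)"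
  shows "P f"
  using assms(1)
proof (induction "card {w. f w \<noteq> \<zero>}" arbitrary: f rule: less_induct)
  case less
  show ?case
  proof (cases "{w. f w \<noteq> \<zero>} = {}")
    case True
    then have "f = \<zero>\<^bsub>free_algebra R X\<^esub>" by (auto simp: fun_eq_iff)
    then show ?thesis using zero by simp
  next
    case False
    then obtain w where w: "f w \<noteq> \<zero>" by auto
    let ?g = "f(w := \<zero>)"
    have fin: "finite {w. f w \<noteq> \<zero>}" using less.prems by (simp add: in_free_algebra)
    have supp: "{v. ?g v \<noteq> \<zero>} \<subset> {v. f v \<noteq> \<zero>}" using w by auto
    then have "card {v. ?g v \<noteq> \<zero>} < card {v. f v \<noteq> \<zero>}" using fin psubset_card_mono by blast
    moreover have g: "?g \<in> carrier (free_algebra R X)"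
      using less.prems finite_subset[OF _ fin] supp by (auto simp: in_free_algebra)
    ultimately have "P ?g" using less.hyps by blast
    moreover have "f = ?g \<oplus>\<^bsub>free_algebra R X\<^esub> f w \<odot>\<^bsub>free_algebra R X\<^esub> word R w"
      using less.prems by (auto simp: fun_eq_iff word_def free_algebra_closed)
    moreover have "w \<noteq> []" "set w \<subseteq> X" "f w \<in> carrier R"
      using w less.prems by (auto simp: in_free_algebra)
    ultimately show ?thesis using add g by metis
  qed
qed

lemma pairing_superset:
  assumes "f \<in> carrier (free_algebra R X)" "finite A" "{w. f w \<noteq> \<zero>} \<subseteq> A" "\<psi> \<in> UNIV \<rightarrow> carrier R"
  shows "pairing R \<psi> f = (\<Oplus>w\<in>A. f w \<otimes> \<psi> w)"
  unfolding pairing_def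
  by (rule add.finprod_mono_neutral_cong_left)
    (use assms in \<open>auto simp: Pi_def free_algebra_closed\<close>)

lemma pairing_closed:
  assumes "f \<in> carrier (free_algebra R X)" "\<psi> \<in> UNIV \<rightarrow> carrier R"
  shows "pairing R \<psi> f \<in> carrier R"
  unfolding pairing_def using assms by (auto simp: Pi_def free_algebra_closed intro!: finsum_closed)

lemma pairing_add:
  assumes f: "f \<in> carrier (free_algebra R X)" and g: "g \<in> carrier (free_algebra R X)"
    and \<psi>: "\<psi> \<in> UNIV \<rightarrow> carrier R"
  shows "pairing R \<psi> (f \<oplus>\<^bsub>free_algebra R X\<^esub> g) = pairing R \<psi> f \<oplus> pairing R \<psi> g"
proof -
  let ?A = "{w. f w \<noteq> \<zero>} \<union> {w. g w \<noteq> \<zero>}"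
  have A: "finite ?A" using f g by (simp add: in_free_algebra)
  have "{w. (f \<oplus>\<^bsub>free_algebra R X\<^esub> g) w \<noteq> \<zero>} \<subseteq> ?A" by auto
  then have "pairing R \<psi> (f \<oplus>\<^bsub>free_algebra R X\<^esub> g) =
      (\<Oplus>w\<in>?A. (f \<oplus>\<^bsub>free_algebra R X\<^esub> g) w \<otimes> \<psi> w)"
    using pairing_superset free_algebra_add_closed f g \<psi> A by blast
  also have "\<dots> = (\<Oplus>w\<in>?A. f w \<otimes> \<psi> w \<oplus> g w \<otimes> \<psi> w)"
    using f g \<psi> by (intro finsum_cong') (auto simp: l_distr free_algebra_closed Pi_def)
  also have "\<dots> = (\<Oplus>w\<in>?A. f w \<otimes> \<psi> w) \<oplus> (\<Oplus>w\<in>?A. g w \<otimes> \<psi> w)"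
    using f g \<psi> by (intro finsum_addf) (auto simp: free_algebra_closed Pi_def)
  also have "\<dots> = pairing R \<psi> f \<oplus> pairing R \<psi> g"
    using pairing_superset[OF f A _ \<psi>] pairing_superset[OF g A _ \<psi>] by auto
  finally show ?thesis .
qed

lemma pairing_smult:
  assumes a: "a \<in> carrier R" and f: "f \<in> carrier (free_algebra R X)"
    and \<psi>: "\<psi> \<in> UNIV \<rightarrow> carrier R"
  shows "pairing R \<psi> (a \<odot>\<^bsub>free_algebra R X\<^esub> f) = a \<otimes> pairing R \<psi> f"
proof -
  let ?A = "{w. f w \<noteq> \<zero>}"
  have A: "finite ?A" using f by (simp add: in_free_algebra)
  have "{w. (a \<odot>\<^bsub>free_algebra R X\<^esub> f) w \<noteq> \<zero>} \<subseteq> ?A" using a by auto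
  then have "pairing R \<psi> (a \<odot>\<^bsub>free_algebra R X\<^esub> f) = (\<Oplus>w\<in>?A. (a \<odot>\<^bsub>free_algebra R X\<^esub> f) w \<otimes> \<psi> w)"
    using pairing_superset free_algebra_smult_closed a f \<psi> A by blast
  also have "\<dots> = (\<Oplus>w\<in>?A. a \<otimes> (f w \<otimes> \<psi> w))"
    using a f \<psi> by (intro finsum_cong') (auto simp: m_assoc free_algebra_closed Pi_def)
  also have "\<dots> = a \<otimes> pairing R \<psi> f"
    unfolding pairing_def using a f \<psi> A
    by (intro finsum_rdistr[symmetric]) (auto simp: free_algebra_closed Pi_def)
  finally show ?thesis .
qed

lemma pairing_word:
  assumes "\<psi> \<in> UNIV \<rightarrow> carrier R"
  shows "pairing R \<psi> (word R w) = \<psi> w"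
proof (cases "\<one> = \<zero>")
  case True
  then have "carrier R = {\<zero>}" using one_zeroD by simp
  moreover have "pairing R \<psi> (word R w) \<in> carrier R"
    unfolding pairing_def using assms by (intro finsum_closed) (auto simp: word_def Pi_def)
  moreover have "\<psi> w \<in> carrier R" using assms by auto
  ultimately show ?thesis by simp
next
  case False
  then have "{u. word R w u \<noteq> \<zero>} = {w}" by (auto simp: word_def)
  then show ?thesis using assms by (simp add: pairing_def word_def Pi_def)
qed

lemma pairing_zero: "pairing R \<psi> \<zero>\<^bsub>free_algebra R X\<^esub> = \<zero>"
  by (simp add: pairing_def)

declare free_algebra_apply [simp del]

text \<open>
  Both sides are bilinear in \<open>f\<close> and \<open>g\<close>, and on words \<open>u\<close>, \<open>v\<close> both are \<open>\<psi> (u @ v)\<close>.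
\<close>
lemma pairing_mult:
  assumes f: "f \<in> carrier (free_algebra R X)" and g: "g \<in> carrier (free_algebra R X)"
    and \<psi>: "\<psi> \<in> UNIV \<rightarrow> carrier R"
  shows "pairing R \<psi> (f \<otimes>\<^bsub>free_algebra R X\<^esub> g) =
    pairing R (\<lambda>v. pairing R (\<lambda>u. \<psi> (u @ v)) f) g"
proof -
  interpret F: biadditive_module R "free_algebra R X" by (rule free_algebra_biadditive)
  have \<psi>': "(\<lambda>u. \<psi> (u @ v)) \<in> UNIV \<rightarrow> carrier R" for v using \<psi> by auto
  have inner: "(\<lambda>v. pairing R (\<lambda>u. \<psi> (u @ v)) f) \<in> UNIV \<rightarrow> carrier R"
    if "f \<in> carrier (free_algebra R X)" for f
    using pairing_closed[OF that \<psi>'] by auto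
  have word: "pairing R \<psi> (f \<otimes>\<^bsub>free_algebra R X\<^esub> word R w) = pairing R (\<lambda>u. \<psi> (u @ w)) f"
    if w: "w \<noteq> []" "set w \<subseteq> X" for w
    using f
  proof (induction rule: free_algebra_induct)
    case zero
    have "\<zero>\<^bsub>free_algebra R X\<^esub> \<otimes>\<^bsub>free_algebra R X\<^esub> word R w = \<zero>\<^bsub>free_algebra R X\<^esub>"
      using free_algebra_closed[OF word_closed[OF w]]
      by (simp add: fun_eq_iff free_algebra_apply)
    then show ?case by (simp only: pairing_zero)
  next
    case (add a u f)
    note W = word_closed[OF w] word_closed[OF add(2,3)]
    have wc: "word R (u @ w) \<in> carrier (free_algebra R X)"
      by (rule word_closed) (use add(2,3) w in auto)
    have "(f \<oplus>\<^bsub>free_algebra R X\<^esub> a \<odot>\<^bsub>free_algebra R X\<^esub> word R u) \<otimes>\<^bsub>free_algebra R X\<^esub> word R w =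
        f \<otimes>\<^bsub>free_algebra R X\<^esub> word R w \<oplus>\<^bsub>free_algebra R X\<^esub> a \<odot>\<^bsub>free_algebra R X\<^esub> word R (u @ w)"
      using add(1-4) W by (simp add: F.mult_distr_left free_algebra_smult_mult word_mult)
    moreover have "pairing R \<psi> (f \<otimes>\<^bsub>free_algebra R X\<^esub> word R w
          \<oplus>\<^bsub>free_algebra R X\<^esub> a \<odot>\<^bsub>free_algebra R X\<^esub> word R (u @ w)) =
        pairing R \<psi> (f \<otimes>\<^bsub>free_algebra R X\<^esub> word R w) \<oplus> a \<otimes> \<psi> (u @ w)"
      using add(1-4) W wc \<psi> pairing_add[OF F.mult_closed F.smult_closed \<psi>, of f "word R w" a "word R (u @ w)"]
      by (simp add: pairing_smult pairing_word)
    moreover have "pairing R (\<lambda>u. \<psi> (u @ w)) (f \<oplus>\<^bsub>free_algebra R X\<^esub> a \<odot>\<^bsub>free_algebra R X\<^esub> word R u) =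
        pairing R (\<lambda>u. \<psi> (u @ w)) f \<oplus> a \<otimes> \<psi> (u @ w)"
      using add(1-4) W pairing_add[OF _ F.smult_closed \<psi>', of f a "word R u"] pairing_smult[OF _ _ \<psi>', of a "word R u"]
      by (simp add: pairing_word[OF \<psi>'])
    ultimately show ?case using add.IH by simp
  qed
  show ?thesis using g
  proof (induction rule: free_algebra_induct)
    case zero
    have "f \<otimes>\<^bsub>free_algebra R X\<^esub> \<zero>\<^bsub>free_algebra R X\<^esub> = \<zero>\<^bsub>free_algebra R X\<^esub>"
      using f by (auto simp: fun_eq_iff free_algebra_apply free_algebra_closed)
    then show ?case by (simp only: pairing_zero)
  next
    case (add a w g)
    note W = word_closed[OF add(2,3)]
    have "f \<otimes>\<^bsub>free_algebra R X\<^esub> (g \<oplus>\<^bsub>free_algebra R X\<^esub> a \<odot>\<^bsub>free_algebra R X\<^esub> word R w) =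
        f \<otimes>\<^bsub>free_algebra R X\<^esub> g \<oplus>\<^bsub>free_algebra R X\<^esub> a \<odot>\<^bsub>free_algebra R X\<^esub> (f \<otimes>\<^bsub>free_algebra R X\<^esub> word R w)"
      using add(1-4) W f by (simp add: F.mult_distr_right free_algebra_smult_mult)
    moreover have "pairing R \<psi> (f \<otimes>\<^bsub>free_algebra R X\<^esub> g \<oplus>\<^bsub>free_algebra R X\<^esub>
          a \<odot>\<^bsub>free_algebra R X\<^esub> (f \<otimes>\<^bsub>free_algebra R X\<^esub> word R w)) =
        pairing R \<psi> (f \<otimes>\<^bsub>free_algebra R X\<^esub> g) \<oplus> a \<otimes> pairing R (\<lambda>u. \<psi> (u @ w)) f"
      using add(1-4) W f pairing_add[OF F.mult_closed F.smult_closed \<psi>, of f g a "f \<otimes>\<^bsub>free_algebra R X\<^esub> word R w"] pairing_smult[OF _ F.mult_closed \<psi>]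
      by (simp add: word \<psi>)
    moreover have "pairing R (\<lambda>v. pairing R (\<lambda>u. \<psi> (u @ v)) f)
          (g \<oplus>\<^bsub>free_algebra R X\<^esub> a \<odot>\<^bsub>free_algebra R X\<^esub> word R w) =
        pairing R (\<lambda>v. pairing R (\<lambda>u. \<psi> (u @ v)) f) g \<oplus> a \<otimes> pairing R (\<lambda>u. \<psi> (u @ w)) f"
      using add(1-4) W inner[OF f] pairing_add[OF _ F.smult_closed inner[OF f], of g a "word R w"]
        pairing_smult[OF _ _ inner[OF f], of a "word R w"]
      by (simp add: pairing_word[OF inner[OF f]])
    ultimately show ?case using add.IH by simp
  qed
qed

end

section \<open>Digraphs with disjoint cycles\<close>

context wf_digraph
begin

text \<open>
  These are the arcs that lie on some closed walk.
\<close>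
definition cyclic_arc :: "'b \<Rightarrow> bool" where
  "cyclic_arc e \<longleftrightarrow> e \<in> arcs G \<and> head G e \<rightarrow>\<^sup>* tail G e"

text \<open>
  A first return to \<open>t\<close>. Inner vertices other than \<open>t\<close> may be repeated as far as the definition goes;
  that a return loop is a cycle is a consequence of disjointness.
\<close>
definition return_loop :: "'a \<Rightarrow> 'b list \<Rightarrow> bool" where
  "return_loop t c \<longleftrightarrow> c \<noteq> [] \<and> awalk t c t \<and> t \<notin> tail G ` set (tl c)"

declare awalk_append_iff [simp del]

lemma awalk_append_conv: "awalk u (p @ q) v \<longleftrightarrow> (\<exists>w. awalk u p w \<and> awalk w q v)"
  by (induction p arbitrary: u) (auto simp: awalk_simps awalk_hd_in_verts)

lemma awalk_verts_eq_tails: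
  "awalk u p v \<Longrightarrow> awalk_verts u p = map (tail G) p @ [v]"
  by (induction p arbitrary: u) (auto simp: awalk_simps)

lemma awalk_reachable: "awalk u p v \<Longrightarrow> u \<rightarrow>\<^sup>* v"
  by (auto simp: reachable_awalk)

lemma awalk_split_arc:
  assumes "awalk u p v" "e \<in> set p"
  obtains xs ys where "p = xs @ e # ys" "e \<in> arcs G" "awalk u xs (tail G e)"
    "awalk (head G e) ys v"
proof -
  obtain xs ys where "p = xs @ e # ys" using assms(2) by (meson split_list)
  then show ?thesis using that assms(1) by (auto simp: awalk_append_conv awalk_Cons_iff)
qed

lemma cyclic_arcs_of_closed_walk:
  assumes "awalk u p v" "v \<rightarrow>\<^sup>* u" "e \<in> set p"
  shows "cyclic_arc e"
proof -
  obtain xs ys where "e \<in> arcs G" "awalk u xs (tail G e)" "awalk (head G e) ys v"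
    using awalk_split_arc[OF assms(1,3)] by blast
  then show ?thesis
    using assms(2) unfolding cyclic_arc_def by (meson awalk_reachable reachable_trans)
qed

lemma cyclic_arc_cycle:
  assumes "cyclic_arc e"
  obtains p where "awalk (tail G e) (e # p) (tail G e)" "cycle (e # p)"
    "distinct (map (tail G) (e # p))"
proof -
  obtain p where p: "apath (head G e) p (tail G e)"
    using assms by (auto simp: cyclic_arc_def reachable_apath)
  then have walk: "awalk (head G e) p (tail G e)" by (simp add: apath_def)
  then have verts: "awalk_verts (head G e) p = map (tail G) p @ [tail G e]"
    by (rule awalk_verts_eq_tails)
  have closed: "awalk (tail G e) (e # p) (tail G e)"
    using walk assms by (simp add: awalk_Cons_iff cyclic_arc_def)
  moreover have "cycle (e # p)"
    using closed p unfolding cycle_def apath_def by auto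
  moreover have "distinct (map (tail G) (e # p))"
    using p verts by (auto simp: apath_def)
  ultimately show ?thesis by (rule that)
qed

text \<open>
  The decomposition behind the sets of paths that meet their target only at the end.
\<close>
lemma walk_until_first_visit:
  assumes "awalk u p t"
  obtains p1 p2 where "p = p1 @ p2" "awalk u p1 t" "t \<notin> tail G ` set p1" "awalk t p2 t"
proof -
  have "\<exists>p1 p2. p = p1 @ p2 \<and> awalk u p1 t \<and> t \<notin> tail G ` set p1 \<and> awalk t p2 t"
    using assms
  proof (induction p arbitrary: u)
    case Nil
    then show ?case by (auto simp: awalk_Nil_iff)
  next
    case (Cons e p)
    show ?case
    proof (cases "u = t")
      case True
      then have "e # p = [] @ (e # p) \<and> awalk u [] t \<and> t \<notin> tail G ` set [] \<and> awalk t (e # p) t"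
        using Cons.prems by (auto simp: awalk_Nil_iff awalk_hd_in_verts)
      then show ?thesis by blast
    next
      case False
      then obtain p1 p2 where "p = p1 @ p2" "awalk (head G e) p1 t" "t \<notin> tail G ` set p1" "awalk t p2 t"
        using Cons.IH[of "head G e"] Cons.prems by (auto simp: awalk_Cons_iff)
      then have "e # p = (e # p1) @ p2 \<and> awalk u (e # p1) t \<and> t \<notin> tail G ` set (e # p1) \<and> awalk t p2 t"
        using False Cons.prems by (auto simp: awalk_Cons_iff)
      then show ?thesis by blast
    qed
  qed
  then show ?thesis using that by blast
qed

lemma sink_reachable:
  assumes "t \<in> sinks G" "t \<rightarrow>\<^sup>* v"
  shows "v = t"
proof -
  obtain p where "awalk t p v" using assms(2) by (auto simp: reachable_awalk)
  then show ?thesis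
    using assms(1) by (cases p) (auto simp: awalk_simps sinks_def out_arcs_def)
qed

end

context fin_digraph
begin

lemma card_reachable_less:
  assumes "w \<rightarrow>\<^sup>* x" "\<not> x \<rightarrow>\<^sup>* w"
  shows "card {v. x \<rightarrow>\<^sup>* v} < card {v. w \<rightarrow>\<^sup>* v}"
proof (rule psubset_card_mono)
  show "finite {v. w \<rightarrow>\<^sup>* v}"
    by (rule finite_subset[OF _ finite_verts]) (auto simp: reachable_in_verts)
  show "{v. x \<rightarrow>\<^sup>* v} \<subset> {v. w \<rightarrow>\<^sup>* v}"
  proof (rule psubsetI)
    show "{v. x \<rightarrow>\<^sup>* v} \<subseteq> {v. w \<rightarrow>\<^sup>* v}" using reachable_trans[OF assms(1)] by blast
    have "w \<rightarrow>\<^sup>* w" using assms(1) reachable_in_verts(1) reachable_refl by blast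
    then show "{v. x \<rightarrow>\<^sup>* v} \<noteq> {v. w \<rightarrow>\<^sup>* v}" using assms(2) by blast
  qed
qed

lemma card_reaching_less:
  assumes "x \<rightarrow>\<^sup>* w" "\<not> w \<rightarrow>\<^sup>* x"
  shows "card {v. v \<rightarrow>\<^sup>* x} < card {v. v \<rightarrow>\<^sup>* w}"
proof (rule psubset_card_mono)
  show "finite {v. v \<rightarrow>\<^sup>* w}"
    by (rule finite_subset[OF _ finite_verts]) (auto simp: reachable_in_verts)
  show "{v. v \<rightarrow>\<^sup>* x} \<subset> {v. v \<rightarrow>\<^sup>* w}"
  proof (rule psubsetI)
    show "{v. v \<rightarrow>\<^sup>* x} \<subseteq> {v. v \<rightarrow>\<^sup>* w}" using reachable_trans[OF _ assms(1)] by blast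
    have "w \<rightarrow>\<^sup>* w" using assms(1) reachable_in_verts(2) reachable_refl by blast
    then show "{v. v \<rightarrow>\<^sup>* x} \<noteq> {v. v \<rightarrow>\<^sup>* w}" using assms(2) by blast
  qed
qed

end

locale disjoint_cycles_digraph = fin_digraph +
  fixes base :: "'b list set \<Rightarrow> 'a"
  assumes disjoint: "cycles_disjoint G"
    and base_on_cycle: "C \<in> cycles G \<Longrightarrow> base C \<in> cycle_verts G C"
begin

text \<open>
  Each of the two arcs is the first arc of a cycle, and these cycles share the vertex \<open>tail G e\<close>.
  By disjointness they agree up to rotation, and a cycle leaves each of its vertices by one arc only.
\<close>
lemma unique_cyclic_arc:
  assumes e: "cyclic_arc e" and f: "cyclic_arc f" and "tail G e = tail G f"
  shows "e = f"
proof -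
  obtain p where p: "cycle (e # p)" "distinct (map (tail G) (e # p))"
    using cyclic_arc_cycle[OF e] by blast
  obtain q where q: "cycle (f # q)"
    using cyclic_arc_cycle[OF f] by blast
  define C where "C = {rotate n (e # p) |n. True}"
  define D where "D = {rotate n (f # q) |n. True}"
  have mem: "e # p \<in> C" "f # q \<in> D"
    unfolding C_def D_def by (auto intro: exI[of _ 0])
  have "C \<in> cycles G" "D \<in> cycles G" using p q by (auto simp: cycles_def C_def D_def)
  moreover have "tail G e \<in> cycle_verts G C" "tail G f \<in> cycle_verts G D"
    using bexI[OF _ mem(1)] bexI[OF _ mem(2)] unfolding cycle_verts_def by simp_all
  ultimately have "C = D"
    using disjoint assms(3) by (auto simp: cycles_disjoint_def)
  then obtain n where "f # q = rotate n (e # p)" using mem(2) by (auto simp: C_def)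
  then have "f \<in> set (e # p)" by (metis list.set_intros(1) set_rotate)
  moreover have "inj_on (tail G) (set (e # p))" using p(2) by (simp only: distinct_map)
  ultimately show ?thesis using assms(3) by (auto dest: inj_onD)
qed

text \<open>
  A walk along cyclic arcs has no choices to make, so it is determined by its source and its length.
\<close>
lemma cyclic_walks_comparable:
  assumes "awalk u p v" "awalk u q w" "\<forall>e\<in>set p \<union> set q. cyclic_arc e"
  shows "(\<exists>r. q = p @ r) \<or> (\<exists>r. p = q @ r)"
  using assms
proof (induction p arbitrary: u q)
  case (Cons e p)
  show ?case
  proof (cases q)
    case (Cons f q')
    have fe: "tail G f = tail G e" "awalk (head G e) p v" "awalk (head G f) q' w"
      using Cons.prems(1,2) Cons by (simp_all add: awalk_Cons_iff)
    have "f = e"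
      by (rule unique_cyclic_arc) (use Cons.prems(3) Cons fe in simp_all)
    moreover have "(\<exists>r. q' = p @ r) \<or> (\<exists>r. p = q' @ r)"
      by (rule Cons.IH[of "head G e"]) (use fe Cons.prems(3) Cons \<open>f = e\<close> in simp_all)
    ultimately show ?thesis using Cons by auto
  qed simp
qed simp

text \<open>
  Of two return loops one is a prefix of the other, and a proper continuation would visit \<open>t\<close> again.
\<close>
lemma return_loop_unique:
  assumes "return_loop t c" "return_loop t d"
  shows "c = d"
proof -
  have no_proper_prefix: "r = []" if loops: "return_loop t c" "return_loop t (c @ r)" for c r
  proof (rule ccontr)
    assume "r \<noteq> []"
    then obtain e r' where r: "r = e # r'" by (cases r) auto
    obtain w where "awalk t c w" "awalk w (e # r') t"
      using loops(2) by (auto simp: return_loop_def awalk_append_conv r)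
    moreover have "awalk t c t" using loops(1) by (simp add: return_loop_def)
    ultimately have "tail G e = t" using awalk_ends_eqD by (auto simp: awalk_Cons_iff)
    moreover have "e \<in> set (tl (c @ r))" using loops(1) by (cases c) (auto simp: return_loop_def r)
    ultimately show False using loops(2) by (auto simp: return_loop_def)
  qed
  have "awalk t c t" "awalk t d t" using assms by (auto simp: return_loop_def)
  moreover have "\<forall>e\<in>set c \<union> set d. cyclic_arc e"
    using calculation cyclic_arcs_of_closed_walk awalk_reachable by blast
  ultimately have "(\<exists>r. d = c @ r) \<or> (\<exists>r. c = d @ r)" by (rule cyclic_walks_comparable)
  then show ?thesis using no_proper_prefix assms by auto
qed

text \<open>
  Cut the walk at its returns to \<open>t\<close>; each piece is a return loop and hence equal to \<open>c\<close>.
\<close>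
lemma closed_walk_is_loop_power:
  assumes c: "return_loop t c" and "awalk t r t"
  shows "\<exists>k. r = concat (replicate k c)"
  using assms(2)
proof (induction "length r" arbitrary: r rule: less_induct)
  case less
  show ?case
  proof (cases "r = []")
    case True
    then have "r = concat (replicate 0 c)" by simp
    then show ?thesis by blast
  next
    case False
    have "awalk (head G (hd r)) (tl r) t"
      using less.prems False by (cases r) (auto simp: awalk_Cons_iff)
    then obtain p1 p2 where p: "tl r = p1 @ p2" "awalk (head G (hd r)) p1 t"
      "t \<notin> tail G ` set p1" "awalk t p2 t"
      using walk_until_first_visit by metis
    have "return_loop t (hd r # p1)"
      using p less.prems False by (cases r) (auto simp: return_loop_def awalk_Cons_iff)
    then have "c = hd r # p1" using return_loop_unique c by blast
    then have r: "r = c @ p2" using p(1) False by (cases r) auto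
    then have "length p2 < length r" using c by (auto simp: return_loop_def)
    then obtain k where "p2 = concat (replicate k c)" using less.hyps p(4) by blast
    then have "r = concat (replicate (Suc k) c)" using r by simp
    then show ?thesis by blast
  qed
qed

lemma base_loop:
  assumes "C \<in> cycles G"
  obtains c where "c \<in> C" "awalk (base C) c (base C)" "return_loop (base C) c"
proof -
  obtain c0 where C: "C = {rotate n c0 |n. True}" and "cycle c0"
    using assms by (auto simp: cycles_def)
  then obtain u where u: "awalk u c0 u" "distinct (tl (awalk_verts u c0))" "c0 \<noteq> []"
    by (auto simp: cycle_def)
  have "base C \<in> tail G ` set c0"
    using base_on_cycle[OF assms] by (auto simp: cycle_verts_def C)
  then obtain e where e: "e \<in> set c0" "base C = tail G e" by blast
  then obtain xs ys where c0: "c0 = xs @ e # ys" "e \<in> arcs G" "awalk u xs (tail G e)"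
    "awalk (head G e) ys u"
    using awalk_split_arc u(1) by metis
  let ?c = "e # ys @ xs"
  have "rotate (length xs) c0 = ?c" using c0(1) rotate_append[of xs "e # ys"] by simp
  then have mem: "?c \<in> C" unfolding C by (metis (mono_tags, lifting) mem_Collect_eq)
  have walk: "awalk (base C) ?c (base C)"
    using c0 e by (auto simp: awalk_Cons_iff awalk_append_conv)
  have "distinct (map (tail G) c0)"
  proof -
    obtain f fs where f: "c0 = f # fs" using u(3) by (cases c0) auto
    have "tl (awalk_verts u c0) = map (tail G) fs @ [tail G f]"
      using awalk_verts_eq_tails[OF u(1)] u(1) by (auto simp: f awalk_Cons_iff)
    then show ?thesis using u(2) by (auto simp: f)
  qed
  then have "return_loop (base C) ?c"
    using walk e(2) by (auto simp: return_loop_def c0(1))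
  then show ?thesis using that mem walk by blast
qed

text \<open>
  Any rotation of the cycle that is a closed walk at the base vertex is a power of the return loop there,
  and its length forces the exponent to be one.
\<close>
lemma cycle_representative_return_loop:
  assumes "C \<in> cycles G" "c \<in> C" "awalk (base C) c (base C)"
  shows "return_loop (base C) c"
proof -
  obtain d where d: "d \<in> C" "return_loop (base C) d" using base_loop[OF assms(1)] by blast
  obtain c0 where C: "C = {rotate n c0 |n. True}" "cycle c0" using assms(1) by (auto simp: cycles_def)
  then have len: "length c = length d" "c \<noteq> []"
    using assms(2) d(1) by (auto simp: cycle_def)
  obtain k where k: "c = concat (replicate k d)"
    using closed_walk_is_loop_power[OF d(2) assms(3)] by blast
  then have "length c = k * length d" by (simp add: length_concat sum_list_replicate)
  then have "k = 1" using len by (cases "d = []") auto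
  then show ?thesis using k d by simp
qed

text \<open>
  The vertices at which the paths of basis elements end.
\<close>
definition terminals :: "'a set" where
  "terminals = sinks G \<union> base ` cycles G"

lemma terminal_in_verts: "t \<in> terminals \<Longrightarrow> t \<in> verts G"
  using base_loop awalk_hd_in_verts by (auto simp: terminals_def sinks_def)

lemma cyclic_arc_reaches_base:
  assumes "cyclic_arc e"
  obtains C where "C \<in> cycles G" "tail G e \<rightarrow>\<^sup>* base C" "base C \<rightarrow>\<^sup>* tail G e"
proof -
  obtain p where p: "awalk (tail G e) (e # p) (tail G e)" "cycle (e # p)"
    using cyclic_arc_cycle[OF assms] by blast
  define C where "C = {rotate n (e # p) |n. True}"
  have C: "C \<in> cycles G" using p by (auto simp: cycles_def C_def)
  then have "base C \<in> tail G ` set (e # p)"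
    using base_on_cycle[OF C] unfolding cycle_verts_def C_def by (auto simp del: rotate_Suc)
  then obtain f where f: "f \<in> set (e # p)" "base C = tail G f" by blast
  obtain xs ys where "awalk (tail G e) xs (tail G f)" "awalk (head G f) ys (tail G e)" "f \<in> arcs G"
    using awalk_split_arc[OF p(1) f(1)] by metis
  then have "tail G e \<rightarrow>\<^sup>* base C" "base C \<rightarrow>\<^sup>* tail G e"
    using awalk_reachable[of "tail G f" "f # ys"] by (auto simp: f(2) awalk_Cons_iff intro: awalk_reachable)
  then show ?thesis using that C by blast
qed

lemma return_loop_unless_sink:
  assumes "t \<in> terminals" "t \<notin> sinks G"
  obtains c where "return_loop t c"
  using assms base_loop by (auto simp: terminals_def)

text \<open>
  No two terminals lie in the same strongly connected component: a sink reaches only itself, and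
  a base vertex reachable from and reaching \<open>base C\<close> lies on the closed walks at \<open>base C\<close>, hence on \<open>C\<close>.
\<close>
lemma terminals_eqI:
  assumes t: "t \<in> terminals" and t': "t' \<in> terminals" and "t \<rightarrow>\<^sup>* t'" "t' \<rightarrow>\<^sup>* t"
  shows "t = t'"
proof (cases "t \<in> sinks G \<or> t' \<in> sinks G")
  case True
  then show ?thesis using sink_reachable assms by metis
next
  case False
  obtain C where C: "C \<in> cycles G" "t = base C" using t False by (auto simp: terminals_def)
  obtain D where D: "D \<in> cycles G" "t' = base D" using t' False by (auto simp: terminals_def)
  obtain c where c: "c \<in> C" "awalk t c t" "return_loop t c" using base_loop C by metis
  obtain p where p: "awalk t p t'" using assms(3) by (auto simp: reachable_awalk)
  obtain q where q: "awalk t' q t" using assms(4) by (auto simp: reachable_awalk)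
  have "awalk t (p @ q) t" using p q by (auto simp: awalk_append_conv)
  then obtain k where k: "p @ q = concat (replicate k c)"
    using closed_walk_is_loop_power[OF c(3)] by blast
  have "t' \<in> tail G ` set c"
  proof (cases q)
    case Nil
    then have "t' = t" using q by (simp add: awalk_Nil_iff)
    then show ?thesis using c by (cases c) (auto simp: return_loop_def awalk_Cons_iff)
  next
    case (Cons e q')
    then have "e \<in> set (concat (replicate k c))" using k[symmetric] by simp
    then have "e \<in> set c" by auto
    then show ?thesis using q Cons by (auto simp: awalk_Cons_iff)
  qed
  then have "t' \<in> cycle_verts G C" using c(1) by (auto simp: cycle_verts_def)
  moreover have "t' \<in> cycle_verts G D" using base_on_cycle D by simp
  ultimately have "C = D" using disjoint C D by (auto simp: cycles_disjoint_def)
  then show ?thesis using C D by simp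
qed

end

section \<open>Monomials of the Leavitt path algebra\<close>

locale leavitt_algebra = R: cring R + disjoint_cycles_digraph G base
  for R :: "('k, 'm) ring_scheme" and G :: "('v, 'e) pre_digraph" and base
begin

abbreviation "F \<equiv> leavitt_free_algebra R G"
abbreviation "L \<equiv> leavitt_path_algebra R G"
abbreviation "cls w \<equiv> leavitt_class R G w"

definition generator_word :: "('v, 'e) leavitt_gen list \<Rightarrow> bool" where
  "generator_word w \<longleftrightarrow> w \<noteq> [] \<and> set w \<subseteq> leavitt_gens G"

lemma in_leavitt_gens [simp]:
  "Vertex v \<in> leavitt_gens G \<longleftrightarrow> v \<in> verts G"
  "Arrow e \<in> leavitt_gens G \<longleftrightarrow> e \<in> arcs G"
  "Ghost e \<in> leavitt_gens G \<longleftrightarrow> e \<in> arcs G"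
  by (auto simp: leavitt_gens_def)

lemma word_in_F: "generator_word w \<Longrightarrow> word R w \<in> carrier F"
  unfolding leavitt_free_algebra_def generator_word_def by (auto intro: R.word_closed)

lemma word_mult_F: "word R u \<otimes>\<^bsub>F\<^esub> word R v = word R (u @ v)"
  unfolding leavitt_free_algebra_def by (rule R.word_mult)

sublocale F: biadditive_module R F
  unfolding leavitt_free_algebra_def by (rule R.free_algebra_biadditive)

lemma relations_in_F: "leavitt_relations R G \<subseteq> carrier F"
proof -
  have w: "word R [Vertex v] \<in> carrier F" if "v \<in> verts G" for v
    using that by (auto intro!: word_in_F simp: generator_word_def)
  moreover have "word R [Arrow e] \<in> carrier F" "word R [Ghost e] \<in> carrier F" if "e \<in> arcs G" for e
    using that by (auto intro!: word_in_F simp: generator_word_def)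
  moreover have "(\<Oplus>\<^bsub>F\<^esub>e\<in>out_arcs G v. word R [Arrow e] \<otimes>\<^bsub>F\<^esub> word R [Ghost e]) \<in> carrier F" for v
    using calculation by (intro F.M.finsum_closed) (auto simp: out_arcs_def)
  ultimately show ?thesis
    unfolding leavitt_relations_def Let_def
    by (intro Un_least subsetI) auto
qed

sublocale P: presented_algebra R F "leavitt_relations R G"
  by (intro presented_algebra.intro F.biadditive_module_axioms presented_algebra_axioms.intro
      relations_in_F)

lemma class_conv: "cls w = P.cls (word R w)"
  by (simp add: leavitt_class_def leavitt_ideal_def)

lemma L_conv: "L = P.Q"
  by (simp add: leavitt_path_algebra_def leavitt_ideal_def)

sublocale L: biadditive_module R L
  unfolding L_conv by (rule P.quotient_biadditive_module)

lemma class_closed: "generator_word w \<Longrightarrow> cls w \<in> carrier L"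
  by (simp add: class_conv L_conv word_in_F)

lemma class_mult:
  "generator_word u \<Longrightarrow> generator_word v \<Longrightarrow> cls u \<otimes>\<^bsub>L\<^esub> cls v = cls (u @ v)"
  by (simp add: class_conv L_conv P.cls_mult word_in_F word_mult_F)

lemma relation_class_eq:
  assumes "word R u \<ominus>\<^bsub>F\<^esub> y \<in> leavitt_relations R G" "generator_word u" "y \<in> carrier F"
  shows "cls u = P.cls y"
  using P.cls_eq_iff[OF word_in_F[OF assms(2)] assms(3)] assms(1)
  by (auto simp: class_conv intro: algebra_ideal.gen)

lemma class_Vertex_Vertex:
  assumes "v \<in> verts G" "w \<in> verts G"
  shows "cls [Vertex v, Vertex w] = (if v = w then cls [Vertex v] else \<zero>\<^bsub>L\<^esub>)"
proof -
  have "(word R [Vertex v] \<otimes>\<^bsub>F\<^esub> word R [Vertex w])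
      \<ominus>\<^bsub>F\<^esub> (if v = w then word R [Vertex v] else \<zero>\<^bsub>F\<^esub>) \<in> leavitt_relations R G"
    using assms unfolding leavitt_relations_def Let_def by blast
  then have "cls [Vertex v, Vertex w] = P.cls (if v = w then word R [Vertex v] else \<zero>\<^bsub>F\<^esub>)"
    using assms by (intro relation_class_eq)
      (auto simp: word_mult_F generator_word_def intro!: word_in_F)
  then show ?thesis by (simp add: class_conv P.cls_zero L_conv)
qed

lemma class_absorb:
  assumes "e \<in> arcs G"
  shows "cls [Vertex (tail G e), Arrow e] = cls [Arrow e]"
    and "cls [Arrow e, Vertex (head G e)] = cls [Arrow e]"
    and "cls [Vertex (head G e), Ghost e] = cls [Ghost e]"
    and "cls [Ghost e, Vertex (tail G e)] = cls [Ghost e]"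
proof -
  have gw: "generator_word [Vertex (tail G e), Arrow e]" "generator_word [Arrow e, Vertex (head G e)]"
    "generator_word [Vertex (head G e), Ghost e]" "generator_word [Ghost e, Vertex (tail G e)]"
    "generator_word [Arrow e]" "generator_word [Ghost e]"
    using assms by (auto simp: generator_word_def)
  have r: "(word R [Vertex (tail G e)] \<otimes>\<^bsub>F\<^esub> word R [Arrow e]) \<ominus>\<^bsub>F\<^esub> word R [Arrow e] \<in> leavitt_relations R G"
    "(word R [Arrow e] \<otimes>\<^bsub>F\<^esub> word R [Vertex (head G e)]) \<ominus>\<^bsub>F\<^esub> word R [Arrow e] \<in> leavitt_relations R G"
    "(word R [Vertex (head G e)] \<otimes>\<^bsub>F\<^esub> word R [Ghost e]) \<ominus>\<^bsub>F\<^esub> word R [Ghost e] \<in> leavitt_relations R G"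
    "(word R [Ghost e] \<otimes>\<^bsub>F\<^esub> word R [Vertex (tail G e)]) \<ominus>\<^bsub>F\<^esub> word R [Ghost e] \<in> leavitt_relations R G"
    using assms unfolding leavitt_relations_def Let_def by blast+
  note r' = r[unfolded word_mult_F append.simps]
  show "cls [Vertex (tail G e), Arrow e] = cls [Arrow e]"
    using relation_class_eq[OF r'(1) gw(1) word_in_F[OF gw(5)]] by (simp add: class_conv)
  show "cls [Arrow e, Vertex (head G e)] = cls [Arrow e]"
    using relation_class_eq[OF r'(2) gw(2) word_in_F[OF gw(5)]] by (simp add: class_conv)
  show "cls [Vertex (head G e), Ghost e] = cls [Ghost e]"
    using relation_class_eq[OF r'(3) gw(3) word_in_F[OF gw(6)]] by (simp add: class_conv)
  show "cls [Ghost e, Vertex (tail G e)] = cls [Ghost e]"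
    using relation_class_eq[OF r'(4) gw(4) word_in_F[OF gw(6)]] by (simp add: class_conv)
qed

lemma class_Ghost_Arrow:
  assumes "e \<in> arcs G" "f \<in> arcs G"
  shows "cls [Ghost e, Arrow f] = (if e = f then cls [Vertex (head G e)] else \<zero>\<^bsub>L\<^esub>)"
proof -
  have "(word R [Ghost e] \<otimes>\<^bsub>F\<^esub> word R [Arrow f])
      \<ominus>\<^bsub>F\<^esub> (if e = f then word R [Vertex (head G e)] else \<zero>\<^bsub>F\<^esub>) \<in> leavitt_relations R G"
    using assms unfolding leavitt_relations_def Let_def by blast
  then have "cls [Ghost e, Arrow f] = P.cls (if e = f then word R [Vertex (head G e)] else \<zero>\<^bsub>F\<^esub>)"
    using assms by (intro relation_class_eq)
      (auto simp: word_mult_F generator_word_def intro!: word_in_F)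
  then show ?thesis by (simp add: class_conv P.cls_zero L_conv)
qed

lemma class_Vertex_expand:
  assumes "v \<in> verts G" "out_arcs G v \<noteq> {}"
  shows "cls [Vertex v] = (\<Oplus>\<^bsub>L\<^esub>e\<in>out_arcs G v. cls [Arrow e, Ghost e])"
proof -
  have w: "word R [Arrow e, Ghost e] \<in> carrier F" if "e \<in> out_arcs G v" for e
    using that by (intro word_in_F) (auto simp: generator_word_def)
  have "word R [Vertex v] \<ominus>\<^bsub>F\<^esub> (\<Oplus>\<^bsub>F\<^esub>e\<in>out_arcs G v. word R [Arrow e] \<otimes>\<^bsub>F\<^esub> word R [Ghost e])
      \<in> leavitt_relations R G"
    using assms finite_out_arcs unfolding leavitt_relations_def Let_def by blast
  then have "cls [Vertex v] = P.cls (\<Oplus>\<^bsub>F\<^esub>e\<in>out_arcs G v. word R [Arrow e, Ghost e])"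
    using assms w unfolding word_mult_F append.simps
    by (intro relation_class_eq F.M.finsum_closed) (auto simp: generator_word_def)
  also have "\<dots> = (\<Oplus>\<^bsub>L\<^esub>e\<in>out_arcs G v. cls [Arrow e, Ghost e])"
    unfolding class_conv L_conv
    using w finite_out_arcs by (intro P.cls_finsum) auto
  finally show ?thesis .
qed

text \<open>
  Replacing a word by its context \<open>x @ _ @ y\<close> on the level of classes. The algebra has no unit, so that
  empty contexts do not correspond to a multiplication and are treated separately.
\<close>
definition in_context ::
    "('v, 'e) leavitt_gen list \<Rightarrow> ('v, 'e) leavitt_gen list \<Rightarrow>
      (('v, 'e) leavitt_gen list \<Rightarrow> 'k) set \<Rightarrow> (('v, 'e) leavitt_gen list \<Rightarrow> 'k) set" where
  "in_context x y Z =
     (let Z' = if x = [] then Z else cls x \<otimes>\<^bsub>L\<^esub> Z in if y = [] then Z' else Z' \<otimes>\<^bsub>L\<^esub> cls y)"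

lemma in_context_class:
  assumes "generator_word w" "set x \<subseteq> leavitt_gens G" "set y \<subseteq> leavitt_gens G"
  shows "in_context x y (cls w) = cls (x @ w @ y)"
  using assms by (auto simp: in_context_def Let_def class_mult generator_word_def)

lemma in_context_additive:
  assumes "set x \<subseteq> leavitt_gens G" "set y \<subseteq> leavitt_gens G"
  shows "Z \<in> carrier L \<Longrightarrow> in_context x y Z \<in> carrier L"
    and "Z \<in> carrier L \<Longrightarrow> Z' \<in> carrier L \<Longrightarrow>
      in_context x y (Z \<oplus>\<^bsub>L\<^esub> Z') = in_context x y Z \<oplus>\<^bsub>L\<^esub> in_context x y Z'"
    and "in_context x y \<zero>\<^bsub>L\<^esub> = \<zero>\<^bsub>L\<^esub>"
proof -
  have c: "cls x \<in> carrier L" if "x \<noteq> []" using that assms by (auto intro!: class_closed simp: generator_word_def)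
  have d: "cls y \<in> carrier L" if "y \<noteq> []" using that assms by (auto intro!: class_closed simp: generator_word_def)
  show closed: "Z \<in> carrier L \<Longrightarrow> in_context x y Z \<in> carrier L" for Z
    using c d by (simp add: in_context_def Let_def)
  show add: "Z \<in> carrier L \<Longrightarrow> Z' \<in> carrier L \<Longrightarrow>
      in_context x y (Z \<oplus>\<^bsub>L\<^esub> Z') = in_context x y Z \<oplus>\<^bsub>L\<^esub> in_context x y Z'" for Z Z'
    using c d by (simp add: in_context_def Let_def L.mult_distr_left L.mult_distr_right)
  show "in_context x y \<zero>\<^bsub>L\<^esub> = \<zero>\<^bsub>L\<^esub>"
    using add[of "\<zero>\<^bsub>L\<^esub>" "\<zero>\<^bsub>L\<^esub>"] closed[of "\<zero>\<^bsub>L\<^esub>"] by simp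
qed

lemma class_replace:
  assumes "cls w = cls w'" "generator_word w" "generator_word w'"
    "set x \<subseteq> leavitt_gens G" "set y \<subseteq> leavitt_gens G"
  shows "cls (x @ w @ y) = cls (x @ w' @ y)"
  using in_context_class[OF assms(2,4,5)] in_context_class[OF assms(3,4,5)] assms(1) by simp

lemma class_zero_context:
  assumes "cls w = \<zero>\<^bsub>L\<^esub>" "generator_word w" "set x \<subseteq> leavitt_gens G" "set y \<subseteq> leavitt_gens G"
  shows "cls (x @ w @ y) = \<zero>\<^bsub>L\<^esub>"
  using in_context_class[OF assms(2,3,4)] in_context_additive(3)[OF assms(3,4)] assms(1) by simp

text \<open>
  A word for \<open>p q*\<close>. The vertices at both ends ensure that it, and the parts to the left and to the
  right of its middle, are nonempty words also for paths of length 0.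
\<close>
definition monomial :: "'v \<Rightarrow> 'e list \<Rightarrow> 'e list \<Rightarrow> 'v \<Rightarrow> ('v, 'e) leavitt_gen list" where
  "monomial u p q v = Vertex u # map Arrow p @ map Ghost (rev q) @ [Vertex v]"

lemma generator_images [simp]:
  "Arrow ` A \<subseteq> leavitt_gens G \<longleftrightarrow> A \<subseteq> arcs G"
  "Ghost ` A \<subseteq> leavitt_gens G \<longleftrightarrow> A \<subseteq> arcs G"
  by auto

lemma awalk_arcs: "awalk u p v \<Longrightarrow> set p \<subseteq> arcs G"
  by (simp add: awalk_def)

lemma monomial_generator_word:
  "awalk u p x \<Longrightarrow> awalk v q x \<Longrightarrow> generator_word (monomial u p q v)"
  using awalk_arcs[of u p x] awalk_arcs[of v q x] awalk_hd_in_verts[of u p x] awalk_hd_in_verts[of v q x]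
  by (auto simp: monomial_def generator_word_def)

text \<open>
  The last arc of \<open>p\<close>, or the vertex \<open>u\<close> if there is none, absorbs its target \<open>x\<close>.
\<close>
lemma class_insert_vertex:
  assumes "awalk u p x" "set y \<subseteq> leavitt_gens G"
  shows "cls (Vertex u # map Arrow p @ Vertex x # y) = cls (Vertex u # map Arrow p @ y)"
proof (cases p rule: rev_cases)
  case Nil
  then have "u = x" "x \<in> verts G" using assms by (auto simp: awalk_Nil_iff)
  then show ?thesis
    using class_replace[of "[Vertex x, Vertex x]" "[Vertex x]" "[]" y] assms Nil class_Vertex_Vertex
    by (simp add: generator_word_def)
next
  case (snoc p' e)
  then have "e \<in> arcs G" "x = head G e" "u \<in> verts G" "set p' \<subseteq> arcs G"
    using assms(1) awalk_arcs[OF assms(1)] by (auto simp: awalk_append_conv awalk_simps awalk_hd_in_verts)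
  then show ?thesis
    using class_replace[of "[Arrow e, Vertex x]" "[Arrow e]" "Vertex u # map Arrow p'" y]
      class_absorb(2)[of e] assms(2) snoc
    by (simp add: generator_word_def)
qed

text \<open>
  An arrow lengthens \<open>p\<close>. A ghost arrow shortens \<open>p\<close> by (CK1), or lengthens \<open>q\<close> if \<open>p\<close> has length 0.
  If the ends do not match, the product vanishes, since distinct vertices are orthogonal.
\<close>
lemma class_generator_monomial:
  assumes g: "g \<in> leavitt_gens G" and p: "awalk u p x" and q: "awalk v q x"
  shows "cls (g # monomial u p q v) = \<zero>\<^bsub>L\<^esub> \<or>
    (\<exists>u' p' q' x'. awalk u' p' x' \<and> awalk v q' x' \<and>
      cls (g # monomial u p q v) = cls (monomial u' p' q' v))"
proof -
  let ?y = "map Arrow p @ map Ghost (rev q) @ [Vertex v]"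
  have y: "set ?y \<subseteq> leavitt_gens G" and u: "u \<in> verts G" and v: "v \<in> verts G"
    and pq: "set p \<subseteq> arcs G" "set q \<subseteq> arcs G"
    using monomial_generator_word[OF p q] awalk_arcs[OF p] awalk_arcs[OF q]
    by (auto simp: monomial_def generator_word_def)
  consider (Vertex) w where "g = Vertex w" "w \<in> verts G" | (Arrow) e where "g = Arrow e" "e \<in> arcs G"
    | (Ghost) e where "g = Ghost e" "e \<in> arcs G"
    using g by (auto simp: leavitt_gens_def)
  then show ?thesis
  proof cases
    case Vertex
    have gw: "generator_word [Vertex w, Vertex u]" using Vertex u by (simp add: generator_word_def)
    show ?thesis
    proof (cases "w = u")
      case True
      then have "cls (g # monomial u p q v) = cls (monomial u p q v)"
        using class_replace[of "[Vertex w, Vertex u]" "[Vertex u]" "[]" ?y] gw y u Vertex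
          class_Vertex_Vertex[of u u]
        by (simp add: monomial_def generator_word_def)
      then show ?thesis using p q by blast
    next
      case False
      then have "cls (g # monomial u p q v) = \<zero>\<^bsub>L\<^esub>"
        using class_zero_context[of "[Vertex w, Vertex u]" "[]" ?y] gw y u Vertex
          class_Vertex_Vertex[of w u]
        by (simp add: monomial_def)
      then show ?thesis by blast
    qed
  next
    case Arrow
    have 1: "cls (g # monomial u p q v) = cls (Arrow e # Vertex (head G e) # monomial u p q v)"
      using class_replace[of "[Arrow e, Vertex (head G e)]" "[Arrow e]" "[]" "monomial u p q v"]
        class_absorb(2)[OF Arrow(2)] Arrow monomial_generator_word[OF p q]
      by (simp add: generator_word_def)
    show ?thesis
    proof (cases "head G e = u")
      case True
      have 2: "cls (Arrow e # Vertex u # ?y) = cls (Arrow e # ?y)"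
        using class_replace[of "[Arrow e, Vertex (head G e)]" "[Arrow e]" "[]" ?y]
          class_absorb(2)[OF Arrow(2)] Arrow u y True
        by (simp add: generator_word_def)
      have 3: "cls (Vertex (tail G e) # Arrow e # ?y) = cls (Arrow e # ?y)"
        using class_replace[of "[Vertex (tail G e), Arrow e]" "[Arrow e]" "[]" ?y]
          class_absorb(1)[OF Arrow(2)] Arrow y
        by (simp add: generator_word_def)
      have "cls (g # monomial u p q v) = cls (monomial (tail G e) (e # p) q v)"
        using 2 3 Arrow by (simp add: monomial_def)
      moreover have "awalk (tail G e) (e # p) x" using p True Arrow by (simp add: awalk_Cons_iff)
      ultimately show ?thesis using q by blast
    next
      case False
      then have "cls (g # monomial u p q v) = \<zero>\<^bsub>L\<^esub>"
        using class_zero_context[of "[Vertex (head G e), Vertex u]" "[Arrow e]" ?y] y u Arrow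
          class_Vertex_Vertex[of "head G e" u] 1
        by (simp add: monomial_def generator_word_def)
      then show ?thesis by blast
    qed
  next
    case Ghost
    have 1: "cls (g # monomial u p q v) = cls (Ghost e # Vertex (tail G e) # monomial u p q v)"
      using class_replace[of "[Ghost e, Vertex (tail G e)]" "[Ghost e]" "[]" "monomial u p q v"]
        class_absorb(4)[OF Ghost(2)] Ghost monomial_generator_word[OF p q]
      by (simp add: generator_word_def)
    show ?thesis
    proof (cases "tail G e = u")
      case True
      have 2: "cls (Ghost e # Vertex u # ?y) = cls (Ghost e # ?y)"
        using class_replace[of "[Ghost e, Vertex (tail G e)]" "[Ghost e]" "[]" ?y]
          class_absorb(4)[OF Ghost(2)] Ghost u y True
        by (simp add: generator_word_def)
      show ?thesis
      proof (cases p)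
        case Nil
        have 3: "cls (Vertex (head G e) # Ghost e # ?y) = cls (Ghost e # ?y)"
          using class_replace[of "[Vertex (head G e), Ghost e]" "[Ghost e]" "[]" ?y]
            class_absorb(3)[OF Ghost(2)] Ghost y
          by (simp add: generator_word_def)
        have "cls (g # monomial u p q v) = cls (monomial (head G e) [] (q @ [e]) v)"
          using 2 3 Ghost Nil by (simp add: monomial_def)
        moreover have "awalk (head G e) [] (head G e)" using Ghost by (simp add: awalk_Nil_iff)
        moreover have "awalk v (q @ [e]) (head G e)"
          using q p Nil True Ghost by (auto simp: awalk_append_conv awalk_simps)
        ultimately show ?thesis by blast
      next
        case (Cons f p')
        let ?y' = "map Arrow p' @ map Ghost (rev q) @ [Vertex v]"
        have f: "f \<in> arcs G" "awalk (head G f) p' x" using p Cons by (auto simp: awalk_Cons_iff)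
        have y': "set ?y' \<subseteq> leavitt_gens G" using y Cons by auto
        show ?thesis
        proof (cases "e = f")
          case True
          then have "cls (Ghost e # ?y) = cls (Vertex (head G e) # ?y')"
            using class_replace[of "[Ghost e, Arrow f]" "[Vertex (head G e)]" "[]" ?y'] y' f Ghost
              class_Ghost_Arrow[of e f] Cons
            by (simp add: generator_word_def)
          then have "cls (g # monomial u p q v) = cls (monomial (head G e) p' q v)"
            using 2 Ghost by (simp add: monomial_def)
          then show ?thesis using f q True by blast
        next
          case False
          then have "cls (Ghost e # ?y) = \<zero>\<^bsub>L\<^esub>"
            using class_zero_context[of "[Ghost e, Arrow f]" "[]" ?y'] y' f Ghost
              class_Ghost_Arrow[of e f] Cons
            by (simp add: generator_word_def)
          then have "cls (g # monomial u p q v) = \<zero>\<^bsub>L\<^esub>"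
            using 2 Ghost by (simp add: monomial_def)
          then show ?thesis by blast
        qed
      qed
    next
      case False
      then have "cls (g # monomial u p q v) = \<zero>\<^bsub>L\<^esub>"
        using class_zero_context[of "[Vertex (tail G e), Vertex u]" "[Ghost e]" ?y] y u Ghost
          class_Vertex_Vertex[of "tail G e" u] 1
        by (simp add: monomial_def generator_word_def)
      then show ?thesis by blast
    qed
  qed
qed

lemma class_append_monomial:
  assumes "set w \<subseteq> leavitt_gens G" "awalk u p x" "awalk v q x"
  shows "cls (w @ monomial u p q v) = \<zero>\<^bsub>L\<^esub> \<or>
    (\<exists>u' p' q' x'. awalk u' p' x' \<and> awalk v q' x' \<and>
      cls (w @ monomial u p q v) = cls (monomial u' p' q' v))"
  using assms(1)
proof (induction w)
  case Nil
  show ?case using assms(2,3) unfolding append_Nil by blast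
next
  case (Cons g w)
  have gw: "generator_word (w @ monomial u p q v)"
    using Cons.prems monomial_generator_word[OF assms(2,3)] by (auto simp: generator_word_def)
  have g: "g \<in> leavitt_gens G" using Cons.prems by simp
  have "cls (w @ monomial u p q v) = \<zero>\<^bsub>L\<^esub> \<or> (\<exists>u' p' q' x'. awalk u' p' x' \<and> awalk v q' x' \<and>
      cls (w @ monomial u p q v) = cls (monomial u' p' q' v))"
    using Cons by simp
  then show ?case
  proof (elim disjE exE conjE)
    assume "cls (w @ monomial u p q v) = \<zero>\<^bsub>L\<^esub>"
    then show ?thesis using class_zero_context[OF _ gw, of "[g]" "[]"] g by simp
  next
    fix u' p' q' x'
    assume *: "awalk u' p' x'" "awalk v q' x'" "cls (w @ monomial u p q v) = cls (monomial u' p' q' v)"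
    then have "cls (g # w @ monomial u p q v) = cls (g # monomial u' p' q' v)"
      using class_replace[OF *(3) gw monomial_generator_word[OF *(1,2)], of "[g]" "[]"] g by simp
    then show ?thesis using class_generator_monomial[OF g *(1,2)] by simp
  qed
qed

text \<open>
  The last generator of \<open>w\<close> absorbs its end vertex \<open>x\<close>, which may be doubled to give the monomial of two paths
  of length 0 at \<open>x\<close>. The other generators then act on monomials from the left.
\<close>
lemma class_word_monomial:
  assumes "generator_word w"
  shows "cls w = \<zero>\<^bsub>L\<^esub> \<or> (\<exists>u p q v x. awalk u p x \<and> awalk v q x \<and> cls w = cls (monomial u p q v))"
proof -
  obtain w' g where w: "w = w' @ [g]" using assms by (cases w rule: rev_cases) (auto simp: generator_word_def)
  have g: "g \<in> leavitt_gens G" "set w' \<subseteq> leavitt_gens G" using assms w by (auto simp: generator_word_def)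
  obtain x where x: "x \<in> verts G" "cls [g, Vertex x] = cls [g]"
  proof -
    consider (Vertex) v where "g = Vertex v" "v \<in> verts G" | (Arrow) e where "g = Arrow e" "e \<in> arcs G"
      | (Ghost) e where "g = Ghost e" "e \<in> arcs G"
      using g by (auto simp: leavitt_gens_def)
    then show ?thesis
    proof cases
      case Vertex then show ?thesis using that[of v] class_Vertex_Vertex[of v v] by simp
    next
      case Arrow then show ?thesis using that[of "head G e"] class_absorb(2)[of e] by simp
    next
      case Ghost then show ?thesis using that[of "tail G e"] class_absorb(4)[of e] by simp
    qed
  qed
  have walk: "awalk x [] x" using x(1) by (simp add: awalk_Nil_iff)
  have "cls (w @ [Vertex x]) = cls w"
    using class_replace[of "[g, Vertex x]" "[g]" w' "[]"] x g w by (simp add: generator_word_def)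
  moreover have "cls (w @ [Vertex x, Vertex x]) = cls (w @ [Vertex x])"
    using class_replace[of "[Vertex x, Vertex x]" "[Vertex x]" w "[]"] class_Vertex_Vertex[of x x] x assms
    by (simp add: generator_word_def)
  ultimately have eq: "cls w = cls (w @ monomial x [] [] x)" by (simp add: monomial_def)
  show ?thesis
    using class_append_monomial[OF _ walk walk, of w] assms unfolding eq generator_word_def by blast
qed

text \<open>
  Insert the vertex \<open>x\<close> between \<open>p\<close> and \<open>q*\<close> and expand it by (CK2).
\<close>
lemma class_monomial_expand:
  assumes p: "awalk u p x" and q: "awalk v q x" and "out_arcs G x \<noteq> {}"
  shows "cls (monomial u p q v) = (\<Oplus>\<^bsub>L\<^esub>e\<in>out_arcs G x. cls (monomial u (p @ [e]) (q @ [e]) v))"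
proof -
  let ?l = "Vertex u # map Arrow p" and ?r = "map Ghost (rev q) @ [Vertex v]"
  have x: "x \<in> verts G" using p by (rule awalk_last_in_verts)
  have l: "set ?l \<subseteq> leavitt_gens G" and r: "set ?r \<subseteq> leavitt_gens G"
    using monomial_generator_word[OF p q] by (auto simp: monomial_def generator_word_def)
  have e: "generator_word [Arrow e, Ghost e]" if "e \<in> out_arcs G x" for e
    using that by (simp add: generator_word_def)
  have "cls (monomial u p q v) = cls (?l @ [Vertex x] @ ?r)"
    using class_insert_vertex[OF p r] by (simp add: monomial_def)
  also have "\<dots> = in_context ?l ?r (cls [Vertex x])"
    using in_context_class[OF _ l r, of "[Vertex x]"] x by (simp add: generator_word_def)
  also have "\<dots> = in_context ?l ?r (\<Oplus>\<^bsub>L\<^esub>e\<in>out_arcs G x. cls [Arrow e, Ghost e])"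
    using class_Vertex_expand[OF x assms(3)] by simp
  also have "\<dots> = (\<Oplus>\<^bsub>L\<^esub>e\<in>out_arcs G x. in_context ?l ?r (cls [Arrow e, Ghost e]))"
    by (rule additive_map_finsum)
      (use L.M.abelian_monoid_axioms finite_out_arcs class_closed e in_context_additive[OF l r] in auto)
  also have "\<dots> = (\<Oplus>\<^bsub>L\<^esub>e\<in>out_arcs G x. cls (?l @ [Arrow e, Ghost e] @ ?r))"
  proof (rule L.M.finsum_cong')
    show "(\<lambda>e. cls (?l @ [Arrow e, Ghost e] @ ?r)) \<in> out_arcs G x \<rightarrow> carrier L"
      using l r by (intro Pi_I class_closed) (simp add: generator_word_def)
  qed (simp_all only: in_context_class[OF e l r])
  also have "\<dots> = (\<Oplus>\<^bsub>L\<^esub>e\<in>out_arcs G x. cls (monomial u (p @ [e]) (q @ [e]) v))"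
    by (simp add: monomial_def)
  finally show ?thesis .
qed

end

section \<open>Spanning\<close>

abbreviation loop_power :: "'e list \<Rightarrow> nat \<Rightarrow> 'e list" where
  "loop_power c k \<equiv> concat (replicate k c)"

context disjoint_cycles_digraph
begin

text \<open>
  Meaningful where a return loop exists; there the choice is unique. A sink has none.
\<close>
definition loop :: "'a \<Rightarrow> 'b list" where
  "loop t = (SOME c. return_loop t c)"

lemma loop_eq: "return_loop t c \<Longrightarrow> loop t = c"
  unfolding loop_def using return_loop_unique by blast

lemma return_loop_loop: "t \<in> terminals \<Longrightarrow> t \<notin> sinks G \<Longrightarrow> return_loop t (loop t)"
  using return_loop_unless_sink loop_eq by metis

lemma sink_no_return_loop: "t \<in> sinks G \<Longrightarrow> \<not> return_loop t c"
  by (cases c) (auto simp: return_loop_def sinks_def out_arcs_def awalk_Cons_iff)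

lemma sink_not_tail: "t \<in> sinks G \<Longrightarrow> awalk u p v \<Longrightarrow> t \<notin> tail G ` set p"
  by (auto simp: sinks_def out_arcs_def awalk_def)

lemma awalk_loop_power: "awalk t c t \<Longrightarrow> awalk t (loop_power c k) t"
  by (induction k) (auto simp: awalk_append_conv awalk_Nil_iff awalk_hd_in_verts)

text \<open>
  An index \<open>(t, u, p, v, q, n)\<close> stands for \<open>p C^n q*\<close>, where \<open>p\<close> and \<open>q\<close> run from \<open>u\<close> and \<open>v\<close> to \<open>t\<close> and
  \<open>C\<close> is the cycle at \<open>t\<close>. Sinks are included as the terminals without a cycle, with exponent 0.
\<close>
definition basis_indices :: "('a \<times> 'a \<times> 'b list \<times> 'a \<times> 'b list \<times> int) set" where
  "basis_indices = {(t, u, p, v, q, n). t \<in> terminals \<and> (t \<in> sinks G \<longrightarrow> n = 0) \<and>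
     awalk u p t \<and> t \<notin> tail G ` set p \<and> awalk v q t \<and> t \<notin> tail G ` set q}"

end

context leavitt_algebra
begin

lemma path_elt_class:
  assumes "awalk u p t"
  shows "path_elt R G (u, p) = cls (Vertex u # map Arrow p)"
proof (cases p)
  case (Cons e p')
  then have "e \<in> arcs G" "u = tail G e" "set p' \<subseteq> arcs G"
    using assms awalk_arcs[OF assms] by (auto simp: awalk_Cons_iff)
  then show ?thesis
    using class_replace[of "[Vertex u, Arrow e]" "[Arrow e]" "[]" "map Arrow p'"]
      class_absorb(1)[of e] Cons
    by (simp add: generator_word_def)
qed simp

lemma ghost_elt_class:
  assumes "awalk v q t"
  shows "ghost_elt R G (v, q) = cls (map Ghost (rev q) @ [Vertex v])"
proof (cases q)
  case (Cons e q')
  then have "e \<in> arcs G" "v = tail G e" "set q' \<subseteq> arcs G"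
    using assms awalk_arcs[OF assms] by (auto simp: awalk_Cons_iff)
  then show ?thesis
    using class_replace[of "[Ghost e, Vertex v]" "[Ghost e]" "map Ghost (rev q')" "[]"]
      class_absorb(4)[of e] Cons
    by (simp add: generator_word_def)
qed simp

lemma generator_word_path: "awalk u p t \<Longrightarrow> generator_word (Vertex u # map Arrow p)"
  and generator_word_ghost: "awalk u p t \<Longrightarrow> generator_word (map Ghost (rev p) @ [Vertex u])"
  using awalk_arcs awalk_hd_in_verts by (auto simp: generator_word_def)

lemma path_ghost_product:
  assumes "awalk u p t" "awalk v q t"
  shows "path_elt R G (u, p) \<otimes>\<^bsub>L\<^esub> ghost_elt R G (v, q) = cls (monomial u p q v)"
  using assms class_mult generator_word_path generator_word_ghost
  by (simp add: path_elt_class ghost_elt_class monomial_def del: path_elt.simps ghost_elt.simps)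

lemma path_power_ghost_product:
  assumes p: "awalk u p t" and c: "awalk t c t" "c \<noteq> []" and q: "awalk v q t"
  shows "path_elt R G (u, p) \<otimes>\<^bsub>L\<^esub> cycle_power R G (t, c) n \<otimes>\<^bsub>L\<^esub> ghost_elt R G (v, q) =
    cls (monomial u (p @ loop_power c (nat n)) (q @ loop_power c (nat (- n))) v)"
proof -
  define w where "w = (if n = 0 then [Vertex t] else
    map Arrow (loop_power c (nat n)) @ map Ghost (rev (loop_power c (nat (- n)))))"
  have w: "cycle_power R G (t, c) n = cls w"
    by (auto simp: w_def map_concat rev_concat rev_map)
  have t: "t \<in> verts G" using c awalk_hd_in_verts by blast
  have "generator_word w"
    using awalk_arcs[OF c(1)] c(2) t by (auto simp: w_def generator_word_def)
  moreover have "generator_word ((Vertex u # map Arrow p) @ w)"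
    using calculation generator_word_path[OF p] by (auto simp: generator_word_def)
  ultimately have "path_elt R G (u, p) \<otimes>\<^bsub>L\<^esub> cycle_power R G (t, c) n \<otimes>\<^bsub>L\<^esub> ghost_elt R G (v, q) =
      cls ((Vertex u # map Arrow p) @ w @ map Ghost (rev q) @ [Vertex v])"
    using generator_word_path[OF p] generator_word_ghost[OF q]
    by (simp add: path_elt_class[OF p] ghost_elt_class[OF q] w class_mult
        del: path_elt.simps ghost_elt.simps cycle_power.simps)
  also have "\<dots> = cls (monomial u (p @ loop_power c (nat n)) (q @ loop_power c (nat (- n))) v)"
  proof (cases "n = 0")
    case True
    have "set (map Ghost (rev q) @ [Vertex v]) \<subseteq> leavitt_gens G"
      using generator_word_ghost[OF q] unfolding generator_word_def by blast
    then show ?thesis using class_insert_vertex[OF p] True by (simp add: w_def monomial_def)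
  next
    case False
    then show ?thesis by (simp add: w_def monomial_def)
  qed
  finally show ?thesis .
qed

text \<open>
  A negative exponent becomes a power of the cycle at the end of \<open>q\<close>, because \<open>C*^n q* = (q C^n)*\<close>.
  Truncation by \<open>nat\<close> makes one of the two powers empty.
\<close>
fun basis_word :: "'v \<times> 'v \<times> 'e list \<times> 'v \<times> 'e list \<times> int \<Rightarrow> ('v, 'e) leavitt_gen list" where
  "basis_word (t, u, p, v, q, n) =
     monomial u (p @ loop_power (loop t) (nat n)) (q @ loop_power (loop t) (nat (- n))) v"

definition basis_elements :: "(('v, 'e) leavitt_gen list \<Rightarrow> 'k) set set" where
  "basis_elements = (\<lambda>i. cls (basis_word i)) ` basis_indices"

lemma basis_elements_eq:
  "{path_elt R G p \<otimes>\<^bsub>L\<^esub> ghost_elt R G q |p q w.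
      w \<in> sinks G \<and> p \<in> paths_to G w \<and> q \<in> paths_to G w} \<union>
   {path_elt R G p \<otimes>\<^bsub>L\<^esub> cycle_power R G (base C, c) n \<otimes>\<^bsub>L\<^esub> ghost_elt R G q |p q C c n.
      C \<in> cycles G \<and> c \<in> C \<and> awalk (base C) c (base C) \<and>
      p \<in> first_paths_to G (base C) \<and> q \<in> first_paths_to G (base C)} = basis_elements"
  (is "?A \<union> ?B = _")
proof (intro equalityI Un_least subsetI)
  fix z assume "z \<in> ?A"
  then obtain u p v q w where w: "w \<in> sinks G" "awalk u p w" "awalk v q w"
    and z: "z = path_elt R G (u, p) \<otimes>\<^bsub>L\<^esub> ghost_elt R G (v, q)"
    by (auto simp: paths_to_def)
  have "w \<notin> tail G ` set p" "w \<notin> tail G ` set q"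
    using w sink_not_tail by auto
  then have "(w, u, p, v, q, 0) \<in> basis_indices"
    using w by (auto simp: basis_indices_def terminals_def)
  moreover have "z = cls (basis_word (w, u, p, v, q, 0))"
    unfolding z path_ghost_product[OF w(2,3)] by simp
  ultimately show "z \<in> basis_elements" unfolding basis_elements_def by blast
next
  fix z assume "z \<in> ?B"
  then obtain u p v q C c n where C: "C \<in> cycles G" "c \<in> C" "awalk (base C) c (base C)"
    and p: "awalk u p (base C)" "base C \<notin> tail G ` set p"
    and q: "awalk v q (base C)" "base C \<notin> tail G ` set q"
    and z: "z = path_elt R G (u, p) \<otimes>\<^bsub>L\<^esub> cycle_power R G (base C, c) n \<otimes>\<^bsub>L\<^esub> ghost_elt R G (v, q)"
    by (auto simp: paths_to_def first_paths_to_def)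
  have loop: "return_loop (base C) c" by (rule cycle_representative_return_loop[OF C])
  then have "(base C, u, p, v, q, n) \<in> basis_indices"
    using C p q sink_no_return_loop by (auto simp: basis_indices_def terminals_def)
  moreover have "z = cls (basis_word (base C, u, p, v, q, n))"
    unfolding z using path_power_ghost_product[OF p(1) C(3) _ q(1)] loop loop_eq[OF loop]
    by (simp add: return_loop_def)
  ultimately show "z \<in> basis_elements" unfolding basis_elements_def by blast
next
  fix z assume "z \<in> basis_elements"
  then obtain t u p v q n where i: "(t, u, p, v, q, n) \<in> basis_indices"
    and z: "z = cls (basis_word (t, u, p, v, q, n))"
    by (auto simp: basis_elements_def)
  then have p: "awalk u p t" "t \<notin> tail G ` set p" and q: "awalk v q t" "t \<notin> tail G ` set q"
    by (auto simp: basis_indices_def)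
  show "z \<in> ?A \<union> ?B"
  proof (cases "t \<in> sinks G")
    case True
    then have "z = path_elt R G (u, p) \<otimes>\<^bsub>L\<^esub> ghost_elt R G (v, q)"
      using z i unfolding path_ghost_product[OF p(1) q(1)] by (simp add: basis_indices_def)
    moreover have "(u, p) \<in> paths_to G t" "(v, q) \<in> paths_to G t" using p q by (auto simp: paths_to_def)
    ultimately have "z \<in> ?A" using True by blast
    then show ?thesis by blast
  next
    case False
    then obtain C where C: "C \<in> cycles G" "t = base C"
      using i by (auto simp: basis_indices_def terminals_def)
    obtain c where c: "c \<in> C" "awalk t c t" "return_loop t c" using base_loop C by metis
    have "z = path_elt R G (u, p) \<otimes>\<^bsub>L\<^esub> cycle_power R G (t, c) n \<otimes>\<^bsub>L\<^esub> ghost_elt R G (v, q)"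
      unfolding z using path_power_ghost_product[OF p(1) c(2) _ q(1)] c(3) loop_eq[OF c(3)]
      by (simp add: return_loop_def)
    moreover have "(u, p) \<in> first_paths_to G t" "(v, q) \<in> first_paths_to G t"
      using p q by (auto simp: first_paths_to_def paths_to_def)
    ultimately have "z \<in> ?B" using C c by blast
    then show ?thesis by blast
  qed
qed

lemma basis_index_walks:
  assumes "(t, u, p, v, q, n) \<in> basis_indices"
  shows "return_loop t (loop t) \<or> n = 0"
    and "awalk u (p @ loop_power (loop t) (nat n)) t"
    and "awalk v (q @ loop_power (loop t) (nat (- n))) t"
proof -
  have *: "awalk u p t" "awalk v q t" "t \<in> terminals" "t \<in> sinks G \<longrightarrow> n = 0"
    using assms by (auto simp: basis_indices_def)
  then show loop: "return_loop t (loop t) \<or> n = 0" using return_loop_loop by blast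
  have "awalk t (loop_power (loop t) k) t" if "k = nat n \<or> k = nat (- n)" for k
    using loop that awalk_loop_power terminal_in_verts[OF *(3)]
    by (auto simp: return_loop_def awalk_Nil_iff)
  then show "awalk u (p @ loop_power (loop t) (nat n)) t"
    "awalk v (q @ loop_power (loop t) (nat (- n))) t"
    using * unfolding awalk_append_conv by blast+
qed

lemma basis_word_generator_word:
  assumes "i \<in> basis_indices"
  shows "generator_word (basis_word i)"
proof -
  obtain t u p v q n where i: "i = (t, u, p, v, q, n)" by (cases i) auto
  show ?thesis
    unfolding i basis_word.simps
    by (rule monomial_generator_word) (rule basis_index_walks[OF assms[unfolded i]])+
qed

lemma basis_elements_closed: "basis_elements \<subseteq> carrier L"
  using class_closed basis_word_generator_word by (auto simp: basis_elements_def)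

abbreviation "basis_span \<equiv> linear_span R L basis_elements"

lemma basis_word_in_span: "i \<in> basis_indices \<Longrightarrow> cls (basis_word i) \<in> basis_span"
  using L.linear_span_superset[OF basis_elements_closed] by (auto simp: basis_elements_def)

text \<open>
  The measure for the induction in the spanning argument. It is constant along a cycle and
  decreases along every other arc.
\<close>
definition height :: "'v \<Rightarrow> nat" where
  "height x = card {y. x \<rightarrow>\<^sup>*\<^bsub>G\<^esub> y}"

definition spanned_below :: "nat \<Rightarrow> bool" where
  "spanned_below N \<longleftrightarrow> (\<forall>u p v q x. awalk u p x \<longrightarrow> awalk v q x \<longrightarrow> height x < N \<longrightarrow>
     cls (monomial u p q v) \<in> basis_span)"

lemma height_noncyclic:
  assumes "e \<in> arcs G" "\<not> cyclic_arc e"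
  shows "height (head G e) < height (tail G e)"
  unfolding height_def
  using assms card_reachable_less awalk_reachable[OF arc_implies_awalk] by (simp add: cyclic_arc_def)

lemma height_cyclic:
  assumes "cyclic_arc e"
  shows "height (head G e) = height (tail G e)"
proof -
  have "tail G e \<rightarrow>\<^sup>*\<^bsub>G\<^esub> head G e" "head G e \<rightarrow>\<^sup>*\<^bsub>G\<^esub> tail G e"
    using assms awalk_reachable[OF arc_implies_awalk] by (auto simp: cyclic_arc_def)
  then have "{y. head G e \<rightarrow>\<^sup>*\<^bsub>G\<^esub> y} = {y. tail G e \<rightarrow>\<^sup>*\<^bsub>G\<^esub> y}" using reachable_trans by blast
  then show ?thesis by (simp add: height_def)
qed

text \<open>
  In the expansion of the monomial by (CK2), all arcs other than \<open>e\<close> are not cyclic, so their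
  summands lie in the span by the induction hypothesis \<open>spanned_below\<close>.
\<close>
lemma monomial_cyclic_step:
  assumes p: "awalk u p (tail G e)" and q: "awalk v q (tail G e)" and e: "cyclic_arc e"
    and below: "spanned_below (height (tail G e))"
  shows "cls (monomial u p q v) \<in> basis_span \<longleftrightarrow> cls (monomial u (p @ [e]) (q @ [e]) v) \<in> basis_span"
proof -
  let ?x = "tail G e"
  let ?m = "\<lambda>f. cls (monomial u (p @ [f]) (q @ [f]) v)"
  have e': "e \<in> out_arcs G ?x" using e by (auto simp: cyclic_arc_def)
  have walks: "awalk u (p @ [f]) (head G f)" "awalk v (q @ [f]) (head G f)"
    if "f \<in> out_arcs G ?x" for f
    using that p q by (auto simp: awalk_append_conv awalk_simps)
  then have m: "?m f \<in> carrier L" if "f \<in> out_arcs G ?x" for f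
    using that class_closed monomial_generator_word by blast
  have rest: "(\<Oplus>\<^bsub>L\<^esub>f\<in>out_arcs G ?x - {e}. ?m f) \<in> basis_span"
  proof (rule L.linear_span_finsum[OF basis_elements_closed])
    fix f assume f: "f \<in> out_arcs G ?x - {e}"
    then have "\<not> cyclic_arc f" using unique_cyclic_arc[OF _ e] by auto
    then have "height (head G f) < height ?x" using height_noncyclic[of f] f by simp
    then show "?m f \<in> basis_span" using below walks f unfolding spanned_below_def by blast
  qed (use finite_out_arcs in simp)
  have "cls (monomial u p q v) = (\<Oplus>\<^bsub>L\<^esub>f\<in>out_arcs G ?x. ?m f)"
    using class_monomial_expand[OF p q] e' by blast
  also have "\<dots> = (\<Oplus>\<^bsub>L\<^esub>f\<in>insert e (out_arcs G ?x - {e}). ?m f)"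
    using e' by (simp add: insert_absorb)
  also have "\<dots> = ?m e \<oplus>\<^bsub>L\<^esub> (\<Oplus>\<^bsub>L\<^esub>f\<in>out_arcs G ?x - {e}. ?m f)"
    using m e' finite_out_arcs by (intro L.M.finsum_insert) auto
  finally show ?thesis
    using L.linear_span_add_cancel[OF basis_elements_closed m[OF e'] rest] by simp
qed

lemma monomial_cyclic_walk:
  assumes "awalk u p x" "awalk v q x" "awalk x r y" "\<forall>e\<in>set r. cyclic_arc e"
    and "spanned_below (height x)"
  shows "cls (monomial u p q v) \<in> basis_span \<longleftrightarrow> cls (monomial u (p @ r) (q @ r) v) \<in> basis_span"
  using assms
proof (induction r arbitrary: x p q)
  case (Cons e r)
  have e: "e \<in> arcs G" "x = tail G e" "awalk (head G e) r y"
    using Cons.prems(3) by (auto simp: awalk_Cons_iff)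
  have "cls (monomial u p q v) \<in> basis_span \<longleftrightarrow> cls (monomial u (p @ [e]) (q @ [e]) v) \<in> basis_span"
    using monomial_cyclic_step Cons.prems e by auto
  also have "\<dots> \<longleftrightarrow> cls (monomial u ((p @ [e]) @ r) ((q @ [e]) @ r) v) \<in> basis_span"
  proof (rule Cons.IH)
    show "awalk u (p @ [e]) (head G e)" "awalk v (q @ [e]) (head G e)"
      using Cons.prems(1,2) e by (auto simp: awalk_append_conv awalk_simps)
    show "spanned_below (height (head G e))"
      using Cons.prems(4,5) height_cyclic[of e] e by simp
  qed (use Cons.prems e in auto)
  finally show ?case by simp
qed simp

text \<open>
  Here \<open>p = p1 C^m\<close> and \<open>q = q1 C^n\<close>. With \<open>k = min m n\<close>, the monomial of \<open>p1 C^(m-k)\<close> and \<open>q1 C^(n-k)\<close>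
  has exponent \<open>m - n\<close> and is a basis element; moving it \<open>k\<close> times around the cycle gives the monomial
  of \<open>p\<close> and \<open>q\<close>.
\<close>
lemma monomial_at_base_in_span:
  assumes p: "awalk u p b" and q: "awalk v q b" and b: "b \<in> terminals" "b \<notin> sinks G"
    and below: "spanned_below (height b)"
  shows "cls (monomial u p q v) \<in> basis_span"
proof -
  let ?c = "loop b"
  have c: "return_loop b ?c" using return_loop_loop b by blast
  then have walk: "awalk b ?c b" by (simp add: return_loop_def)
  obtain p1 p2 where p1: "p = p1 @ p2" "awalk u p1 b" "b \<notin> tail G ` set p1" "awalk b p2 b"
    using walk_until_first_visit[OF p] by metis
  obtain q1 q2 where q1: "q = q1 @ q2" "awalk v q1 b" "b \<notin> tail G ` set q1" "awalk b q2 b"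
    using walk_until_first_visit[OF q] by metis
  obtain m n where m: "p2 = loop_power ?c m" and n: "q2 = loop_power ?c n"
    using closed_walk_is_loop_power[OF c] p1(4) q1(4) by metis
  let ?k = "min m n"
  let ?r = "loop_power ?c ?k"
  let ?p = "p1 @ loop_power ?c (m - ?k)" and ?q = "q1 @ loop_power ?c (n - ?k)"
  have "replicate m ?c = replicate (m - ?k) ?c @ replicate ?k ?c"
    "replicate n ?c = replicate (n - ?k) ?c @ replicate ?k ?c"
    by (simp_all flip: replicate_add)
  then have pq: "p = ?p @ ?r" "q = ?q @ ?r" using p1(1) q1(1) m n by simp_all
  have r: "awalk b ?r b" using walk by (rule awalk_loop_power)
  then have cyc: "\<forall>e\<in>set ?r. cyclic_arc e" using cyclic_arcs_of_closed_walk awalk_reachable by blast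
  have walks: "awalk u ?p b" "awalk v ?q b"
    using p1(2) q1(2) awalk_loop_power[OF walk] by (auto simp: awalk_append_conv)
  define i where "i = (b, u, p1, v, q1, int m - int n)"
  have "m - ?k = nat (int m - int n)" "n - ?k = nat (- (int m - int n))" by auto
  then have "monomial u ?p ?q v = basis_word i" by (simp only: i_def basis_word.simps)
  moreover have "i \<in> basis_indices" using b p1 q1 by (simp add: basis_indices_def i_def)
  ultimately have "cls (monomial u ?p ?q v) \<in> basis_span" using basis_word_in_span by simp
  then have "cls (monomial u (?p @ ?r) (?q @ ?r) v) \<in> basis_span"
    using monomial_cyclic_walk[OF walks r cyc below] by blast
  then show ?thesis using pq by simp
qed

lemma monomial_in_span:
  assumes "awalk u p x" "awalk v q x"
  shows "cls (monomial u p q v) \<in> basis_span"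
  using assms
proof (induction "height x" arbitrary: u p v q x rule: less_induct)
  case less
  have below: "spanned_below (height x)" unfolding spanned_below_def using less.hyps by blast
  have x: "x \<in> verts G" using less.prems awalk_last_in_verts by blast
  show ?case
  proof (cases "\<exists>e\<in>out_arcs G x. cyclic_arc e")
    case True
    then obtain e where e: "cyclic_arc e" "tail G e = x" by auto
    then obtain C where C: "C \<in> cycles G" "x \<rightarrow>\<^sup>*\<^bsub>G\<^esub> base C" "base C \<rightarrow>\<^sup>*\<^bsub>G\<^esub> x"
      using cyclic_arc_reaches_base by metis
    obtain r where r: "awalk x r (base C)" using C(2) by (auto simp: reachable_awalk)
    have cyc: "\<forall>e\<in>set r. cyclic_arc e" using cyclic_arcs_of_closed_walk[OF r C(3)] by blast
    have b: "base C \<in> terminals" "base C \<notin> sinks G"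
      using C base_loop sink_no_return_loop by (auto simp: terminals_def)
    have "{y. x \<rightarrow>\<^sup>*\<^bsub>G\<^esub> y} = {y. base C \<rightarrow>\<^sup>*\<^bsub>G\<^esub> y}" using C reachable_trans by blast
    then have "spanned_below (height (base C))" using below by (simp add: height_def)
    then have "cls (monomial u (p @ r) (q @ r) v) \<in> basis_span"
      using less.prems r b by (intro monomial_at_base_in_span) (auto simp: awalk_append_conv)
    then show ?thesis using monomial_cyclic_walk[OF less.prems r cyc below] by blast
  next
    case False
    show ?thesis
    proof (cases "x \<in> sinks G")
      case True
      then have "x \<notin> tail G ` set p" "x \<notin> tail G ` set q"
        using less.prems True sink_not_tail by auto
      then have "(x, u, p, v, q, 0) \<in> basis_indices"
        using less.prems True by (simp add: basis_indices_def terminals_def)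
      then show ?thesis using basis_word_in_span by fastforce
    next
      case nonsink: False
      have "cls (monomial u p q v) = (\<Oplus>\<^bsub>L\<^esub>e\<in>out_arcs G x. cls (monomial u (p @ [e]) (q @ [e]) v))"
        using class_monomial_expand[OF less.prems] nonsink x by (auto simp: sinks_def)
      also have "\<dots> \<in> basis_span"
      proof (rule L.linear_span_finsum[OF basis_elements_closed])
        fix e assume e: "e \<in> out_arcs G x"
        then have "height (head G e) < height x" using height_noncyclic[of e] False by auto
        moreover have "awalk u (p @ [e]) (head G e)" "awalk v (q @ [e]) (head G e)"
          using e less.prems by (auto simp: awalk_append_conv awalk_simps)
        ultimately show "cls (monomial u (p @ [e]) (q @ [e]) v) \<in> basis_span" using less.hyps by blast
      qed (use finite_out_arcs in simp)
      finally show ?thesis .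
    qed
  qed
qed

lemma class_in_span: "generator_word w \<Longrightarrow> cls w \<in> basis_span"
  using class_word_monomial[of w] monomial_in_span L.linear_span_zero by metis

lemma basis_elements_span: "carrier L \<subseteq> basis_span"
proof
  fix z assume "z \<in> carrier L"
  then obtain f where f: "f \<in> carrier F" "z = P.cls f" by (auto simp: L_conv P.carrier_quotient)
  have "P.cls f \<in> basis_span" using f(1) unfolding leavitt_free_algebra_def
  proof (induction rule: R.free_algebra_induct)
    case zero
    show ?case
      using L.linear_span_zero P.cls_zero unfolding leavitt_free_algebra_def[symmetric] L_conv by simp
  next
    case (add a w f)
    have w: "generator_word w" using add by (simp add: generator_word_def)
    have "a \<odot>\<^bsub>L\<^esub> cls w \<in> basis_span"
      using L.linear_span_smult[OF basis_elements_closed add(1)] class_in_span[OF w] by blast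
    moreover have "P.cls (f \<oplus>\<^bsub>F\<^esub> a \<odot>\<^bsub>F\<^esub> word R w) = P.cls f \<oplus>\<^bsub>L\<^esub> a \<odot>\<^bsub>L\<^esub> cls w"
      using add word_in_F[OF w] unfolding leavitt_free_algebra_def[symmetric] L_conv class_conv
      by (simp add: P.cls_add P.cls_smult)
    ultimately show ?case
      using L.linear_span_add[OF basis_elements_closed] add.IH
      unfolding leavitt_free_algebra_def[symmetric] by simp
  qed
  then show "z \<in> basis_span" using f(2) by simp
qed

end

section \<open>Independence\<close>

text \<open>
  A state \<open>State t u p n\<close> stands for the path \<open>p\<close> from \<open>u\<close> to \<open>t\<close> followed by \<open>n\<close> turns of the cycle at \<open>t\<close>.
\<close>
datatype ('v, 'e) state = State (endpoint: 'v) (source: 'v) (route: "'e list") (winding: int)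

context disjoint_cycles_digraph
begin

text \<open>
  At a sink no generator changes the winding number, so that the states there form one copy
  of the paths for each integer.
\<close>
definition states :: "('a, 'b) state set" where
  "states = {s. endpoint s \<in> terminals \<and> awalk (source s) (route s) (endpoint s) \<and>
     endpoint s \<notin> tail G ` set (route s)}"

text \<open>
  Arrows prepend themselves to a state and ghost arrows remove a first arc. An arrow that leaves the
  endpoint completes a turn of the cycle; conversely, a ghost arrow opens a turn when the path has
  length 0. The test \<open>e \<in> arcs G\<close> makes the set of states invariant under arbitrary words.
\<close>
fun act_gen :: "('a, 'b) leavitt_gen \<Rightarrow> ('a, 'b) state \<Rightarrow>
    ('a, 'b) state option" where
  "act_gen (Vertex v) (State t u p n) = (if u = v then Some (State t u p n) else None)"
| "act_gen (Arrow e) (State t u p n) =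
     (if e \<in> arcs G \<and> head G e = u
      then Some (if tail G e = t then (State t t [] (n + 1)) else (State t (tail G e) (e # p) n)) else None)"
| "act_gen (Ghost e) (State t u [] n) =
     (if t \<notin> sinks G \<and> hd (loop t) = e then Some (State t (head G e) (tl (loop t)) (n - 1)) else None)"
| "act_gen (Ghost e) (State t u (f # p) n) = (if f = e then Some (State t (head G e) p n) else None)"

fun act :: "('a, 'b) leavitt_gen list \<Rightarrow> ('a, 'b) state \<Rightarrow>
    ('a, 'b) state option" where
  "act [] s = Some s"
| "act (g # w) s = Option.bind (act w s) (act_gen g)"

lemma act_append: "act (w @ w') s = Option.bind (act w' s) (act w)"
  by (induction w) (auto simp: Option.bind_assoc)

lemma loop_nonsink:
  assumes "t \<in> terminals" "t \<notin> sinks G"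
  obtains e c where "loop t = e # c" "e \<in> arcs G" "tail G e = t" "awalk (head G e) c t"
    "t \<notin> tail G ` set c"
proof (cases "loop t")
  case Nil
  then show ?thesis using return_loop_loop[OF assms] by (simp add: return_loop_def)
next
  case (Cons e c)
  then show ?thesis
    using return_loop_loop[OF assms] that by (auto simp: return_loop_def awalk_Cons_iff)
qed

lemma act_gen_states:
  assumes "s \<in> states" "act_gen g s = Some s'"
  shows "s' \<in> states"
proof -
  obtain t u p n where s: "s = State t u p n" by (cases s) auto
  have t: "t \<in> terminals" "awalk u p t" "t \<notin> tail G ` set p" using assms(1) by (auto simp: states_def s)
  show ?thesis
  proof (cases g)
    case (Vertex v)
    then show ?thesis using assms by (auto simp: s split: if_splits)
  next
    case (Arrow e)
    then show ?thesis
      using assms t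
      by (auto simp: s states_def awalk_simps terminal_in_verts split: if_splits)
  next
    case (Ghost e)
    show ?thesis
    proof (cases p)
      case Nil
      then have nt: "t \<notin> sinks G" "hd (loop t) = e" and s': "s' = State t (head G e) (tl (loop t)) (n - 1)"
        using assms(2) Ghost by (auto simp: s split: if_splits)
      obtain e' c where "loop t = e' # c" "awalk (head G e') c t" "t \<notin> tail G ` set c"
        using loop_nonsink[OF t(1) nt(1)] by metis
      then show ?thesis using t nt by (auto simp: s' states_def)
    next
      case (Cons f p')
      then show ?thesis
        using assms t Ghost by (auto simp: s states_def awalk_Cons_iff split: if_splits)
    qed
  qed
qed

lemma act_states: "s \<in> states \<Longrightarrow> act w s = Some s' \<Longrightarrow> s' \<in> states"
  by (induction w arbitrary: s') (auto simp: bind_eq_Some_conv intro: act_gen_states)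

text \<open>
  Ghost arrows act by the inverse partial injections of the arrows. The only case that needs the
  structure of the digraph is an arrow \<open>e\<close> that leaves the endpoint of \<open>(p, n)\<close>: then \<open>e # p\<close> is the unique
  return loop, and opening the turn recovers \<open>p\<close>.
\<close>
lemma act_gen_Ghost_iff:
  assumes s: "s \<in> states" and s': "s' \<in> states" and e: "e \<in> arcs G"
  shows "act_gen (Ghost e) s = Some s' \<longleftrightarrow> act_gen (Arrow e) s' = Some s"
proof
  assume *: "act_gen (Ghost e) s = Some s'"
  obtain t u p n where st: "s = State t u p n" by (cases s) auto
  have t: "t \<in> terminals" "awalk u p t" "t \<notin> tail G ` set p" using s by (auto simp: states_def st)
  show "act_gen (Arrow e) s' = Some s"
  proof (cases p)
    case Nil
    then have nt: "t \<notin> sinks G" "hd (loop t) = e" and s'': "s' = State t (head G e) (tl (loop t)) (n - 1)"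
      using * by (auto simp: st split: if_splits)
    obtain e' c where "loop t = e' # c" "tail G e' = t"
      using loop_nonsink[OF t(1) nt(1)] by metis
    then show ?thesis using t nt e Nil by (auto simp: s'' st awalk_Nil_iff)
  next
    case (Cons f p')
    then show ?thesis using * t e by (auto simp: st awalk_Cons_iff split: if_splits)
  qed
next
  assume *: "act_gen (Arrow e) s' = Some s"
  obtain t u p n where st: "s' = State t u p n" by (cases s') auto
  have t: "t \<in> terminals" "awalk u p t" "t \<notin> tail G ` set p" using s' by (auto simp: states_def st)
  have u: "head G e = u" using * by (auto simp: st split: if_splits)
  show "act_gen (Ghost e) s = Some s'"
  proof (cases "tail G e = t")
    case True
    then have loop: "return_loop t (e # p)" using t u e by (auto simp: return_loop_def awalk_Cons_iff)
    then have "t \<notin> sinks G" using sink_no_return_loop by blast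
    then show ?thesis using * True u e loop_eq[OF loop] by (auto simp: st)
  next
    case False
    then show ?thesis using * u e by (auto simp: st)
  qed
qed

lemma act_gen_Vertex: "act_gen (Vertex v) s = (if source s = v then Some s else None)"
  by (cases s) auto

lemma act_gen_Arrow_source:
  assumes "act_gen (Arrow e) s = Some s'"
  shows "source s = head G e" "source s' = tail G e" "endpoint s' = endpoint s"
  using assms by (cases s; auto simp: split: if_splits)+

lemma act_gen_Arrow_defined:
  assumes "e \<in> arcs G" "source s = head G e"
  obtains s' where "act_gen (Arrow e) s = Some s'"
  using assms by (cases s) auto

lemma act_gen_Ghost_source:
  assumes "s \<in> states" "e \<in> arcs G" "act_gen (Ghost e) s = Some s'"
  shows "source s = tail G e" "source s' = head G e"
  using act_gen_Ghost_iff[OF assms(1) act_gen_states[OF assms(1,3)] assms(2)] assms(3)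
    act_gen_Arrow_source by simp_all

lemma act_gen_Ghost_unique:
  assumes "act_gen (Ghost e) s \<noteq> None" "act_gen (Ghost f) s \<noteq> None"
  shows "e = f"
proof -
  obtain t u p n where "s = State t u p n" by (cases s) auto
  then show ?thesis using assms by (cases p) (auto split: if_splits)
qed

text \<open>
  Together with the two preceding facts this is (CK2): at a vertex that is not a sink, the ranges of the arrows
  leaving it partition the states with that source.
\<close>
lemma act_gen_Ghost_exists:
  assumes s: "s \<in> states" and "source s \<notin> sinks G"
  obtains e s' where "e \<in> out_arcs G (source s)" "act_gen (Ghost e) s = Some s'"
proof -
  obtain t u p n where st: "s = State t u p n" by (cases s) auto
  have t: "t \<in> terminals" "awalk u p t" "t \<notin> tail G ` set p" using s by (auto simp: states_def st)
  show ?thesis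
  proof (cases p)
    case Nil
    then have u: "u = t" "t \<notin> sinks G" using t assms(2) by (auto simp: st awalk_Nil_iff)
    obtain e c where "loop t = e # c" "e \<in> arcs G" "tail G e = t"
      using loop_nonsink[OF t(1) u(2)] by metis
    then show ?thesis using u Nil by (intro that[of e]) (auto simp: st)
  next
    case (Cons f p')
    then show ?thesis using t by (intro that[of f]) (auto simp: st awalk_Cons_iff)
  qed
qed

text \<open>
  The action of \<open>q*\<close> is the inverse of that of \<open>q\<close>, so that actions of monomials can be computed with
  arrows only.
\<close>
lemma act_Ghosts_iff:
  assumes "s \<in> states" "set q \<subseteq> arcs G"
  shows "act (map Ghost (rev q)) s = Some z \<longleftrightarrow> z \<in> states \<and> act (map Arrow q) z = Some s"
  using assms
proof (induction q arbitrary: s)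
  case (Cons e q)
  have e: "e \<in> arcs G" and q: "set q \<subseteq> arcs G" using Cons.prems by auto
  have inverse: "act_gen (Ghost e) s = Some s' \<longleftrightarrow> s' \<in> states \<and> act_gen (Arrow e) s' = Some s" for s'
    using act_gen_Ghost_iff[OF Cons.prems(1) _ e] act_gen_states[OF Cons.prems(1)] by blast
  have "act (map Ghost (rev (e # q))) s = Some z \<longleftrightarrow>
      (\<exists>s'. act_gen (Ghost e) s = Some s' \<and> act (map Ghost (rev q)) s' = Some z)"
    by (simp add: act_append bind_eq_Some_conv)
  also have "\<dots> \<longleftrightarrow> (\<exists>s'\<in>states. act_gen (Arrow e) s' = Some s \<and> z \<in> states \<and>
      act (map Arrow q) z = Some s')"
    unfolding inverse using Cons.IH[OF _ q] by blast
  also have "\<dots> \<longleftrightarrow> z \<in> states \<and> act (map Arrow (e # q)) z = Some s"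
    using act_states[of z "map Arrow q"] unfolding list.map act.simps bind_eq_Some_conv by blast
  finally show ?case .
qed auto

lemma act_Arrows_source:
  assumes "act (map Arrow q) z = Some s" "awalk (source s) q y"
  shows "source z = y" "endpoint z = endpoint s"
proof -
  have "source z = y \<and> endpoint z = endpoint s" using assms
  proof (induction q arbitrary: s)
    case Nil
    then show ?case by (simp add: awalk_Nil_iff)
  next
    case (Cons e q)
    then obtain s' where s': "act (map Arrow q) z = Some s'" "act_gen (Arrow e) s' = Some s"
      by (auto simp: bind_eq_Some_conv)
    have "awalk (source s') q y" using Cons.prems(2) act_gen_Arrow_source[OF s'(2)] by (simp add: awalk_Cons_iff)
    then show ?case using Cons.IH[OF s'(1)] act_gen_Arrow_source(3)[OF s'(2)] by simp
  qed
  then show "source z = y" "endpoint z = endpoint s" by auto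
qed

lemma act_first_path:
  assumes "awalk u p t" "t \<notin> tail G ` set p"
  shows "act (map Arrow p) (State t t [] n) = Some (State t u p n)"
  using assms by (induction p arbitrary: u) (auto simp: awalk_simps)

lemma act_loop_power:
  assumes "return_loop t c"
  shows "act (map Arrow (loop_power c k)) (State t t [] n) = Some (State t t [] (n + int k))"
proof (induction k)
  case (Suc k)
  obtain e c' where c: "c = e # c'" "e \<in> arcs G" "tail G e = t" "awalk (head G e) c' t" "t \<notin> tail G ` set c'"
    using assms by (cases c) (auto simp: return_loop_def awalk_Cons_iff)
  have "act (map Arrow c) (State t t [] m) = Some (State t t [] (m + 1))" for m
    using act_first_path[OF c(4,5)] c by simp
  then show ?case using Suc by (simp add: act_append add.assoc)
qed simp

lemma act_path_loop_power:
  assumes "awalk u p t" "t \<notin> tail G ` set p" "return_loop t c \<or> k = 0"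
  shows "act (map Arrow (p @ loop_power c k)) (State t t [] n) = Some (State t u p (n + int k))"
  using act_first_path[OF assms(1,2)] assms(3) act_loop_power[of t c k]
  by (auto simp: act_append)

end

context leavitt_algebra
begin

lemma act_monomial_iff:
  assumes s: "s \<in> states" and p: "awalk u p x" and q: "awalk v q x"
  shows "act (monomial u p q v) s = Some y \<longleftrightarrow> source s = v \<and> source y = u \<and>
    (\<exists>z\<in>states. act (map Arrow q) z = Some s \<and> act (map Arrow p) z = Some y)"
proof -
  have "act (monomial u p q v) s = Some y \<longleftrightarrow> source s = v \<and> source y = u \<and>
      (\<exists>z. act (map Ghost (rev q)) s = Some z \<and> act (map Arrow p) z = Some y)"
    by (auto simp: monomial_def act_append bind_eq_Some_conv act_gen_Vertex)
  then show ?thesis using act_Ghosts_iff[OF s awalk_arcs[OF q]] by auto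
qed

lemma act_basis_word:
  assumes i: "(t, u, p, v, q, n) \<in> basis_indices"
  shows "act (basis_word (t, u, p, v, q, n)) (State t v q 0) = Some (State t u p n)"
proof -
  have t: "t \<in> terminals" and p: "awalk u p t" "t \<notin> tail G ` set p"
    and q: "awalk v q t" "t \<notin> tail G ` set q"
    using i by (auto simp: basis_indices_def)
  note w = basis_index_walks[OF i]
  have s: "State t v q 0 \<in> states" using t q by (simp add: states_def)
  \<comment> \<open>The state between the two paths: opening the turns of a negative exponent makes the winding number negative.\<close>
  let ?z = "State t t [] (- int (nat (- n)))"
  have "?z \<in> states" using t by (simp add: states_def awalk_Nil_iff terminal_in_verts)
  moreover have "act (map Arrow (q @ loop_power (loop t) (nat (- n)))) ?z = Some (State t v q 0)"
    using act_path_loop_power[OF q, of "loop t" "nat (- n)" "- int (nat (- n))"] w(1) by auto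
  moreover have "act (map Arrow (p @ loop_power (loop t) (nat n))) ?z = Some (State t u p n)"
    using act_path_loop_power[OF p, of "loop t" "nat n" "- int (nat (- n))"] w(1) by auto
  ultimately show ?thesis
    unfolding basis_word.simps act_monomial_iff[OF s w(2,3)] by auto
qed

text \<open>
  The order on endpoints for the triangular argument: the value increases strictly from a vertex to
  any vertex that it reaches but that does not reach it.
\<close>
definition depth :: "'v \<Rightarrow> nat" where
  "depth x = card {y. y \<rightarrow>\<^sup>*\<^bsub>G\<^esub> x}"

text \<open>
  The intermediate state \<open>z\<close> starts at \<open>t'\<close> and has endpoint \<open>t\<close>, so \<open>t'\<close> reaches \<open>t\<close>. If \<open>t\<close> also reaches
  \<open>t'\<close>, the terminals agree and \<open>z\<close> is a winding number at \<open>t\<close>; then the paths and the exponent can be read off.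
\<close>
lemma act_basis_word_triangular:
  assumes i: "(t, u, p, v, q, n) \<in> basis_indices"
    and i': "(t', u', p', v', q', n') \<in> basis_indices"
    and act: "act (basis_word (t', u', p', v', q', n')) (State t v q 0) = Some (State t u p n)"
  shows "(t', u', p', v', q', n') = (t, u, p, v, q, n) \<or> depth t' < depth t"
proof (cases "t \<rightarrow>\<^sup>*\<^bsub>G\<^esub> t'")
  case True
  have t: "t \<in> terminals" and q: "awalk v q t" "t \<notin> tail G ` set q"
    using i by (auto simp: basis_indices_def)
  have t': "t' \<in> terminals" and p': "awalk u' p' t'" "t' \<notin> tail G ` set p'"
    and q': "awalk v' q' t'" "t' \<notin> tail G ` set q'"
    using i' by (auto simp: basis_indices_def)
  note w = basis_index_walks[OF i']
  have s: "State t v q 0 \<in> states" using t q by (simp add: states_def)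
  obtain z where z: "z \<in> states"
    "act (map Arrow (q' @ loop_power (loop t') (nat (- n')))) z = Some (State t v q 0)"
    "act (map Arrow (p' @ loop_power (loop t') (nat n'))) z = Some (State t u p n)"
    and v: "v = v'"
    using act unfolding basis_word.simps act_monomial_iff[OF s w(2,3)] by auto
  have "source z = t'" "endpoint z = t"
    using act_Arrows_source[OF z(2)] w(3) v by auto
  then obtain r m where zt: "z = State t t' r m" by (cases z) auto
  then have r: "awalk t' r t" "t \<notin> tail G ` set r" using z(1) by (auto simp: states_def)
  have tt: "t' = t" using terminals_eqI[OF t t' True awalk_reachable[OF r(1)]] by simp
  have "r = []" using r by (cases r) (auto simp: tt awalk_Cons_iff)
  then have z': "z = State t' t' [] m" using zt tt by simp
  have "State t v q 0 = State t' v' q' (m + int (nat (- n')))"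
    using act_path_loop_power[OF q', of "loop t'" "nat (- n')" m] w(1) z(2) unfolding z' by auto
  moreover have "State t u p n = State t' u' p' (m + int (nat n'))"
    using act_path_loop_power[OF p', of "loop t'" "nat n'" m] w(1) z(3) unfolding z' by auto
  ultimately show ?thesis by (auto split: if_splits)
next
  case False
  have t: "t \<in> terminals" and q: "awalk v q t" "t \<notin> tail G ` set q"
    using i by (auto simp: basis_indices_def)
  note w = basis_index_walks[OF i']
  have s: "State t v q 0 \<in> states" using t q by (simp add: states_def)
  obtain z where z: "z \<in> states"
    "act (map Arrow (q' @ loop_power (loop t') (nat (- n')))) z = Some (State t v q 0)"
    and v: "v = v'"
    using act unfolding basis_word.simps act_monomial_iff[OF s w(2,3)] by auto
  have "source z = t'" "endpoint z = t"
    using act_Arrows_source[OF z(2)] w(3) v by auto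
  then have "t' \<rightarrow>\<^sup>*\<^bsub>G\<^esub> t" using z(1) awalk_reachable by (auto simp: states_def)
  then show ?thesis using card_reaching_less False by (simp add: depth_def)
qed

text \<open>
  The coefficient of a word at a state: the function \<open>\<phi>\<close> on states is pulled back along the partial
  map of the word and extended by zero. The linear extension \<open>pairing R (evaluate \<phi> s)\<close> is the
  representation of the free algebra on functions, evaluated at \<open>s\<close>.
\<close>
definition evaluate ::
    "(('v, 'e) state \<Rightarrow> 'k) \<Rightarrow> ('v, 'e) state \<Rightarrow> ('v, 'e) leavitt_gen list \<Rightarrow> 'k" where
  "evaluate \<phi> s w = (case act w s of None \<Rightarrow> \<zero>\<^bsub>R\<^esub> | Some s' \<Rightarrow> \<phi> s')"

abbreviation "functions \<equiv> (UNIV \<rightarrow> carrier R) :: (('v, 'e) state \<Rightarrow> 'k) set"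

lemma evaluate_closed: "\<phi> \<in> functions \<Longrightarrow> evaluate \<phi> s \<in> UNIV \<rightarrow> carrier R"
  by (auto simp: evaluate_def Pi_iff split: option.split)

lemma pairing_zero_function: "f \<in> carrier F \<Longrightarrow> pairing R (\<lambda>_. \<zero>\<^bsub>R\<^esub>) f = \<zero>\<^bsub>R\<^esub>"
  unfolding pairing_def leavitt_free_algebra_def
  by (intro R.add.finprod_one_eqI) (simp add: R.free_algebra_closed)

text \<open>
  The right factor acts first on states, so its pull-back is applied last.
\<close>
lemma pairing_evaluate_mult:
  assumes f: "f \<in> carrier F" and g: "g \<in> carrier F" and \<phi>: "\<phi> \<in> functions"
  shows "pairing R (evaluate \<phi> s) (f \<otimes>\<^bsub>F\<^esub> g) =
    pairing R (evaluate (\<lambda>s'. pairing R (evaluate \<phi> s') f) s) g"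
proof -
  have "pairing R (\<lambda>u. evaluate \<phi> s (u @ v)) f = evaluate (\<lambda>s'. pairing R (evaluate \<phi> s') f) s v" for v
  proof (cases "act v s")
    case None
    then have "(\<lambda>u. evaluate \<phi> s (u @ v)) = (\<lambda>_. \<zero>\<^bsub>R\<^esub>)" by (simp add: evaluate_def act_append fun_eq_iff)
    then show ?thesis using None pairing_zero_function[OF f] by (simp add: evaluate_def)
  next
    case (Some s')
    then have "(\<lambda>u. evaluate \<phi> s (u @ v)) = evaluate \<phi> s'"
      by (simp add: evaluate_def act_append fun_eq_iff)
    then show ?thesis using Some by (simp add: evaluate_def)
  qed
  then show ?thesis
    using R.pairing_mult[OF f[unfolded leavitt_free_algebra_def] g[unfolded leavitt_free_algebra_def]
        evaluate_closed[OF \<phi>]]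
    unfolding leavitt_free_algebra_def by simp
qed

text \<open>
  The kernel of the representation. It is a two-sided ideal that contains the relations, hence
  it contains the ideal that they generate.
\<close>
definition annihilated :: "(('v, 'e) leavitt_gen list \<Rightarrow> 'k) set" where
  "annihilated = {f \<in> carrier F. \<forall>\<phi>\<in>functions. \<forall>s\<in>states. pairing R (evaluate \<phi> s) f = \<zero>\<^bsub>R\<^esub>}"

lemma pairing_F:
  assumes "\<psi> \<in> UNIV \<rightarrow> carrier R"
  shows "f \<in> carrier F \<Longrightarrow> pairing R \<psi> f \<in> carrier R"
    and "f \<in> carrier F \<Longrightarrow> g \<in> carrier F \<Longrightarrow>
      pairing R \<psi> (f \<oplus>\<^bsub>F\<^esub> g) = pairing R \<psi> f \<oplus>\<^bsub>R\<^esub> pairing R \<psi> g"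
    and "a \<in> carrier R \<Longrightarrow> f \<in> carrier F \<Longrightarrow> pairing R \<psi> (a \<odot>\<^bsub>F\<^esub> f) = a \<otimes>\<^bsub>R\<^esub> pairing R \<psi> f"
    and "pairing R \<psi> \<zero>\<^bsub>F\<^esub> = \<zero>\<^bsub>R\<^esub>"
  using assms unfolding leavitt_free_algebra_def
  by (simp_all add: R.pairing_closed R.pairing_add R.pairing_smult R.pairing_zero)

lemma pairing_minus:
  assumes \<psi>: "\<psi> \<in> UNIV \<rightarrow> carrier R" and f: "f \<in> carrier F" and g: "g \<in> carrier F"
  shows "pairing R \<psi> (f \<ominus>\<^bsub>F\<^esub> g) = pairing R \<psi> f \<ominus>\<^bsub>R\<^esub> pairing R \<psi> g"
proof -
  have "\<ominus>\<^bsub>F\<^esub> g = (\<ominus>\<^bsub>R\<^esub> \<one>\<^bsub>R\<^esub>) \<odot>\<^bsub>F\<^esub> g" using g by (simp add: F.smult_l_minus)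
  then have "pairing R \<psi> (\<ominus>\<^bsub>F\<^esub> g) = \<ominus>\<^bsub>R\<^esub> pairing R \<psi> g"
    using pairing_F[OF \<psi>] g by (simp add: R.l_minus)
  then show ?thesis using pairing_F[OF \<psi>] f g by (simp add: a_minus_def)
qed

lemma pairing_finsum:
  assumes "\<psi> \<in> UNIV \<rightarrow> carrier R" "finite A" "f \<in> A \<rightarrow> carrier F"
  shows "pairing R \<psi> (\<Oplus>\<^bsub>F\<^esub>x\<in>A. f x) = (\<Oplus>\<^bsub>R\<^esub>x\<in>A. pairing R \<psi> (f x))"
  using F.M.abelian_monoid_axioms R.abelian_monoid_axioms assms(2,3)
  by (rule additive_map_finsum[where h = "pairing R \<psi>"]) (simp_all add: pairing_F[OF assms(1)])

lemma word_relation_annihilated: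
  assumes "generator_word w" "y \<in> carrier F"
    and "\<And>\<phi> s. \<phi> \<in> functions \<Longrightarrow> s \<in> states \<Longrightarrow> pairing R (evaluate \<phi> s) y = evaluate \<phi> s w"
  shows "word R w \<ominus>\<^bsub>F\<^esub> y \<in> annihilated"
proof -
  have "pairing R (evaluate \<phi> s) (word R w \<ominus>\<^bsub>F\<^esub> y) = \<zero>\<^bsub>R\<^esub>"
    if \<phi>: "\<phi> \<in> functions" and s: "s \<in> states" for \<phi> s
  proof -
    have "evaluate \<phi> s w \<in> carrier R" using evaluate_closed[OF \<phi>, of s] by auto
    then show ?thesis
      using pairing_minus[OF evaluate_closed[OF \<phi>] word_in_F[OF assms(1)] assms(2), of s]
        assms(3)[OF \<phi> s] R.pairing_word[OF evaluate_closed[OF \<phi>]]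
      by (simp add: a_minus_def R.r_neg)
  qed
  then show ?thesis using word_in_F[OF assms(1)] assms(2) by (simp add: annihilated_def)
qed

lemma binomial_relation_annihilated:
  assumes "generator_word w" "generator_word w'" "\<And>s. s \<in> states \<Longrightarrow> act w s = act w' s"
  shows "word R w \<ominus>\<^bsub>F\<^esub> word R w' \<in> annihilated"
  using assms word_in_F R.pairing_word[OF evaluate_closed]
  by (intro word_relation_annihilated) (auto simp: evaluate_def)

lemma monomial_relation_annihilated:
  assumes "generator_word w" "\<And>s. s \<in> states \<Longrightarrow> act w s = None"
  shows "word R w \<ominus>\<^bsub>F\<^esub> \<zero>\<^bsub>F\<^esub> \<in> annihilated"
  using assms pairing_F(4)[OF evaluate_closed]
  by (intro word_relation_annihilated) (auto simp: evaluate_def)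

text \<open>
  At a state with source \<open>v\<close>, precisely one arc \<open>e\<close> has a defined ghost action, and \<open>e e*\<close> fixes the state;
  at other states both sides vanish.
\<close>
lemma expansion_relation_annihilated:
  assumes v: "v \<in> verts G" and "out_arcs G v \<noteq> {}"
  shows "word R [Vertex v] \<ominus>\<^bsub>F\<^esub> (\<Oplus>\<^bsub>F\<^esub>e\<in>out_arcs G v. word R [Arrow e, Ghost e]) \<in> annihilated"
proof (rule word_relation_annihilated)
  have w: "word R [Arrow e, Ghost e] \<in> carrier F" if "e \<in> out_arcs G v" for e
    using that by (intro word_in_F) (auto simp: generator_word_def)
  then show "(\<Oplus>\<^bsub>F\<^esub>e\<in>out_arcs G v. word R [Arrow e, Ghost e]) \<in> carrier F"
    by (intro F.M.finsum_closed) auto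
  fix \<phi> s assume \<phi>: "\<phi> \<in> functions" and s: "s \<in> states"
  note closed = evaluate_closed[OF \<phi>, of s]
  have act: "act [Arrow e, Ghost e] s = (if act_gen (Ghost e) s = None then None else Some s)"
    if "e \<in> arcs G" for e
    using act_gen_Ghost_iff[OF s act_gen_states[OF s] that] by (cases "act_gen (Ghost e) s") auto
  have "pairing R (evaluate \<phi> s) (\<Oplus>\<^bsub>F\<^esub>e\<in>out_arcs G v. word R [Arrow e, Ghost e]) =
      (\<Oplus>\<^bsub>R\<^esub>e\<in>out_arcs G v. pairing R (evaluate \<phi> s) (word R [Arrow e, Ghost e]))"
    using w by (intro pairing_finsum[OF closed finite_out_arcs]) auto
  also have "\<dots> = (\<Oplus>\<^bsub>R\<^esub>e\<in>out_arcs G v. evaluate \<phi> s [Arrow e, Ghost e])"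
    by (simp only: R.pairing_word[OF closed])
  also have "\<dots> = evaluate \<phi> s [Vertex v]"
  proof (cases "source s = v")
    case False
    then have "act_gen (Ghost e) s = None" if "e \<in> out_arcs G v" for e
      using that act_gen_Ghost_source(1)[OF s, of e] by (cases "act_gen (Ghost e) s") auto
    then have "evaluate \<phi> s [Arrow e, Ghost e] = \<zero>\<^bsub>R\<^esub>" if "e \<in> out_arcs G v" for e
      using that by (simp add: evaluate_def)
    then have "(\<Oplus>\<^bsub>R\<^esub>e\<in>out_arcs G v. evaluate \<phi> s [Arrow e, Ghost e]) = \<zero>\<^bsub>R\<^esub>"
      by (rule R.add.finprod_one_eqI)
    then show ?thesis using False by (simp add: evaluate_def act_gen_Vertex)
  next
    case True
    have "source s \<notin> sinks G" using True assms by (simp add: sinks_def)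
    then obtain e s' where e: "e \<in> out_arcs G v" "act_gen (Ghost e) s = Some s'"
      using act_gen_Ghost_exists[OF s] True by metis
    have "evaluate \<phi> s [Arrow f, Ghost f] = (if f = e then \<phi> s else \<zero>\<^bsub>R\<^esub>)"
      if f: "f \<in> out_arcs G v" for f
    proof (cases "f = e")
      case True
      have "act [Arrow f, Ghost f] s = Some s" using act[of f] f e True by simp
      then show ?thesis using True by (simp only: evaluate_def option.case if_True refl)
    next
      case False
      then have "act_gen (Ghost f) s = None" using act_gen_Ghost_unique[of f s e] e(2) by fastforce
      then have "act [Arrow f, Ghost f] s = None" using act[of f] f by simp
      then show ?thesis using False by (simp only: evaluate_def option.case if_False)
    qed
    then have "(\<Oplus>\<^bsub>R\<^esub>e\<in>out_arcs G v. evaluate \<phi> s [Arrow e, Ghost e]) =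
        (\<Oplus>\<^bsub>R\<^esub>f\<in>out_arcs G v. if f = e then \<phi> s else \<zero>\<^bsub>R\<^esub>)"
      using \<phi> by (intro R.finsum_cong') auto
    also have "\<dots> = \<phi> s"
      using R.add.finprod_singleton_swap[OF e(1) finite_out_arcs, of "\<lambda>_. \<phi> s"] \<phi> by auto
    finally show ?thesis using True by (simp add: evaluate_def act_gen_Vertex)
  qed
  finally show "pairing R (evaluate \<phi> s) (\<Oplus>\<^bsub>F\<^esub>e\<in>out_arcs G v. word R [Arrow e, Ghost e]) =
      evaluate \<phi> s [Vertex v]" .
qed (use v in \<open>simp add: generator_word_def\<close>)

lemma relations_annihilated: "leavitt_relations R G \<subseteq> annihilated"
proof -
  have VV: "word R [Vertex v, Vertex w] \<ominus>\<^bsub>F\<^esub> (if v = w then word R [Vertex v] else \<zero>\<^bsub>F\<^esub>) \<in> annihilated"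
    if "v \<in> verts G" "w \<in> verts G" for v w
    using that binomial_relation_annihilated[of "[Vertex v, Vertex w]" "[Vertex v]"]
      monomial_relation_annihilated[of "[Vertex v, Vertex w]"]
    by (auto simp: act_gen_Vertex generator_word_def)
  have VA: "word R [Vertex (tail G e), Arrow e] \<ominus>\<^bsub>F\<^esub> word R [Arrow e] \<in> annihilated" if "e \<in> arcs G" for e
  proof (rule binomial_relation_annihilated)
    fix s show "act [Vertex (tail G e), Arrow e] s = act [Arrow e] s"
      using act_gen_Arrow_source(2)[of e s] by (cases "act_gen (Arrow e) s") (auto simp: act_gen_Vertex)
  qed (use that in \<open>auto simp: generator_word_def\<close>)
  have AV: "word R [Arrow e, Vertex (head G e)] \<ominus>\<^bsub>F\<^esub> word R [Arrow e] \<in> annihilated" if "e \<in> arcs G" for e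
  proof (rule binomial_relation_annihilated)
    fix s show "act [Arrow e, Vertex (head G e)] s = act [Arrow e] s"
      using act_gen_Arrow_source(1)[of e s] by (cases "act_gen (Arrow e) s") (auto simp: act_gen_Vertex)
  qed (use that in \<open>auto simp: generator_word_def\<close>)
  have VG: "word R [Vertex (head G e), Ghost e] \<ominus>\<^bsub>F\<^esub> word R [Ghost e] \<in> annihilated" if e: "e \<in> arcs G" for e
  proof (rule binomial_relation_annihilated)
    fix s assume "s \<in> states"
    then show "act [Vertex (head G e), Ghost e] s = act [Ghost e] s"
      using act_gen_Ghost_source(2)[OF _ e, of s] by (cases "act_gen (Ghost e) s") (auto simp: act_gen_Vertex)
  qed (use that in \<open>auto simp: generator_word_def\<close>)
  have GV: "word R [Ghost e, Vertex (tail G e)] \<ominus>\<^bsub>F\<^esub> word R [Ghost e] \<in> annihilated" if e: "e \<in> arcs G" for e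
  proof (rule binomial_relation_annihilated)
    fix s assume "s \<in> states"
    then show "act [Ghost e, Vertex (tail G e)] s = act [Ghost e] s"
      using act_gen_Ghost_source(1)[OF _ e, of s] by (cases "act_gen (Ghost e) s") (auto simp: act_gen_Vertex)
  qed (use that in \<open>auto simp: generator_word_def\<close>)
  have GA: "word R [Ghost e, Arrow f] \<ominus>\<^bsub>F\<^esub> (if e = f then word R [Vertex (head G e)] else \<zero>\<^bsub>F\<^esub>) \<in> annihilated"
    if ef: "e \<in> arcs G" "f \<in> arcs G" for e f
  proof (cases "e = f")
    case True
    have "act [Ghost e, Arrow e] s = act [Vertex (head G e)] s" if s: "s \<in> states" for s
    proof (cases "source s = head G e")
      case src: True
      obtain s' where s': "act_gen (Arrow e) s = Some s'" using act_gen_Arrow_defined[OF ef(1) src] .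
      then have "act_gen (Ghost e) s' = Some s"
        using act_gen_Ghost_iff[OF act_gen_states[OF s s'] s ef(1)] by simp
      then show ?thesis using s' src by (simp add: act_gen_Vertex)
    next
      case False
      then have "act_gen (Arrow e) s = None"
        using act_gen_Arrow_source(1)[of e s] by (cases "act_gen (Arrow e) s") auto
      then show ?thesis using False by (simp add: act_gen_Vertex)
    qed
    then show ?thesis
      using True ef binomial_relation_annihilated[of "[Ghost e, Arrow e]" "[Vertex (head G e)]"]
      by (simp add: generator_word_def)
  next
    case False
    have "act [Ghost e, Arrow f] s = None" if s: "s \<in> states" for s
    proof (cases "act_gen (Arrow f) s")
      case (Some s')
      then have "act_gen (Ghost f) s' = Some s"
        using act_gen_Ghost_iff[OF act_gen_states[OF s Some] s ef(2)] by simp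
      then have "act_gen (Ghost e) s' = None" 
        using act_gen_Ghost_unique[of e s' f] False by (cases "act_gen (Ghost e) s'") auto
      then show ?thesis using Some by simp
    qed simp
    then show ?thesis
      using False ef monomial_relation_annihilated[of "[Ghost e, Arrow f]"]
      by (simp add: generator_word_def)
  qed
  show ?thesis
    unfolding leavitt_relations_def Let_def word_mult_F append.simps
    using VV VA AV VG GV GA expansion_relation_annihilated by (intro Un_least subsetI) blast+
qed

lemma ideal_annihilated:
  assumes "f \<in> P.I"
  shows "f \<in> annihilated"
  using assms
proof (induction rule: algebra_ideal.induct)
  case (gen f)
  then show ?case using relations_annihilated by blast
next
  case zero
  then show ?case using pairing_F(4)[OF evaluate_closed] by (simp add: annihilated_def)
next
  case (add f g)
  then show ?case using pairing_F(2)[OF evaluate_closed] by (simp add: annihilated_def)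
next
  case (smult a f)
  then show ?case using pairing_F(3)[OF evaluate_closed] by (simp add: annihilated_def)
next
  case (mult_left g f)
  have f: "f \<in> carrier F" using mult_left by (simp add: annihilated_def)
  have "pairing R (evaluate \<phi> s) (g \<otimes>\<^bsub>F\<^esub> f) = \<zero>\<^bsub>R\<^esub>" if \<phi>: "\<phi> \<in> functions" and s: "s \<in> states" for \<phi> s
  proof -
    have "(\<lambda>s'. pairing R (evaluate \<phi> s') g) \<in> functions"
      using pairing_F(1)[OF evaluate_closed[OF \<phi>] mult_left(1)] by simp
    then show ?thesis
      using pairing_evaluate_mult[OF mult_left(1) f \<phi>] mult_left.IH s by (simp add: annihilated_def)
  qed
  then show ?case using mult_left f by (simp add: annihilated_def)
next
  case (mult_right g f)
  have f: "f \<in> carrier F" using mult_right by (simp add: annihilated_def)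
  have "pairing R (evaluate \<phi> s) (f \<otimes>\<^bsub>F\<^esub> g) = \<zero>\<^bsub>R\<^esub>" if \<phi>: "\<phi> \<in> functions" and s: "s \<in> states" for \<phi> s
  proof -
    have "evaluate (\<lambda>s'. pairing R (evaluate \<phi> s') f) s w = \<zero>\<^bsub>R\<^esub>" for w
      using mult_right.IH \<phi> act_states[OF s, of w]
      by (auto simp: evaluate_def annihilated_def split: option.split)
    then have "evaluate (\<lambda>s'. pairing R (evaluate \<phi> s') f) s = (\<lambda>_. \<zero>\<^bsub>R\<^esub>)" by (simp add: fun_eq_iff)
    then show ?thesis
      using pairing_evaluate_mult[OF f mult_right(1) \<phi>] pairing_zero_function[OF mult_right(1)] by simp
  qed
  then show ?case using mult_right f by (simp add: annihilated_def)
qed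

lemma evaluate_relation:
  assumes A: "finite A" and a: "a \<in> A \<rightarrow> carrier R" and w: "\<And>b. b \<in> A \<Longrightarrow> generator_word (w b)"
    and zero: "(\<Oplus>\<^bsub>L\<^esub>b\<in>A. a b \<odot>\<^bsub>L\<^esub> cls (w b)) = \<zero>\<^bsub>L\<^esub>"
    and \<phi>: "\<phi> \<in> functions" and s: "s \<in> states"
  shows "(\<Oplus>\<^bsub>R\<^esub>b\<in>A. a b \<otimes>\<^bsub>R\<^esub> evaluate \<phi> s (w b)) = \<zero>\<^bsub>R\<^esub>"
proof -
  let ?f = "\<Oplus>\<^bsub>F\<^esub>b\<in>A. a b \<odot>\<^bsub>F\<^esub> word R (w b)"
  note closed = evaluate_closed[OF \<phi>, of s]
  have c: "a b \<in> carrier R" "word R (w b) \<in> carrier F" if "b \<in> A" for b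
    using that a w word_in_F by auto
  then have t: "(\<lambda>b. a b \<odot>\<^bsub>F\<^esub> word R (w b)) \<in> A \<rightarrow> carrier F" by auto
  have "P.cls ?f = (\<Oplus>\<^bsub>P.Q\<^esub>b\<in>A. P.cls (a b \<odot>\<^bsub>F\<^esub> word R (w b)))"
    by (rule P.cls_finsum[OF A t])
  also have "\<dots> = (\<Oplus>\<^bsub>L\<^esub>b\<in>A. a b \<odot>\<^bsub>L\<^esub> cls (w b))"
    unfolding L_conv[symmetric] using c w class_closed
    by (intro L.M.finsum_cong') (auto simp: L_conv class_conv P.cls_smult)
  finally have "P.cls ?f = \<zero>\<^bsub>P.Q\<^esub>" using zero by (simp add: L_conv)
  then have "?f \<in> annihilated"
    using ideal_annihilated P.cls_zero_iff F.M.finsum_closed[OF t] by blast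
  then have "\<zero>\<^bsub>R\<^esub> = pairing R (evaluate \<phi> s) ?f" using \<phi> s by (simp add: annihilated_def)
  also have "\<dots> = (\<Oplus>\<^bsub>R\<^esub>b\<in>A. pairing R (evaluate \<phi> s) (a b \<odot>\<^bsub>F\<^esub> word R (w b)))"
    by (rule pairing_finsum[OF closed A t])
  also have "\<dots> = (\<Oplus>\<^bsub>R\<^esub>b\<in>A. a b \<otimes>\<^bsub>R\<^esub> evaluate \<phi> s (w b))"
    using c closed
    by (intro R.finsum_cong') (auto simp: pairing_F(3)[OF closed] R.pairing_word[OF closed] Pi_iff)
  finally show ?thesis by simp
qed

text \<open>
  Choose an index of minimal depth among those with nonzero coefficient, and evaluate the combination at
  the state from which it acts, on the indicator function of the state that it reaches. By
  triangularity only its own coefficient survives.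
\<close>
lemma basis_elements_independent:
  assumes A: "finite A" "A \<subseteq> basis_elements" and a: "a \<in> A \<rightarrow> carrier R"
    and zero: "(\<Oplus>\<^bsub>L\<^esub>b\<in>A. a b \<odot>\<^bsub>L\<^esub> b) = \<zero>\<^bsub>L\<^esub>" and "b \<in> A"
  shows "a b = \<zero>\<^bsub>R\<^esub>"
proof (rule ccontr)
  assume "a b \<noteq> \<zero>\<^bsub>R\<^esub>"
  define index where "index b = (SOME i. i \<in> basis_indices \<and> cls (basis_word i) = b)" for b
  have index: "index b \<in> basis_indices" "cls (basis_word (index b)) = b" if "b \<in> A" for b
  proof -
    have "b \<in> basis_elements" using A(2) that by (rule subsetD)
    then obtain i where "b = cls (basis_word i)" "i \<in> basis_indices"
      unfolding basis_elements_def by (rule imageE)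
    then have "\<exists>i. i \<in> basis_indices \<and> cls (basis_word i) = b" by blast
    then have "index b \<in> basis_indices \<and> cls (basis_word (index b)) = b"
      unfolding index_def by (rule someI_ex)
    then show "index b \<in> basis_indices" "cls (basis_word (index b)) = b"
      by (rule conjunct1, rule conjunct2)
  qed
  let ?d = "\<lambda>b. depth (fst (index b))"
  have "\<exists>b0. (b0 \<in> A \<and> a b0 \<noteq> \<zero>\<^bsub>R\<^esub>) \<and> (\<forall>b. b \<in> A \<and> a b \<noteq> \<zero>\<^bsub>R\<^esub> \<longrightarrow> ?d b0 \<le> ?d b)"
    by (rule ex_has_least_nat[where k = b]) (use assms(5) \<open>a b \<noteq> \<zero>\<^bsub>R\<^esub>\<close> in simp)
  then obtain b0 where b0: "b0 \<in> A" "a b0 \<noteq> \<zero>\<^bsub>R\<^esub>"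
    and min: "\<And>b. b \<in> A \<Longrightarrow> a b \<noteq> \<zero>\<^bsub>R\<^esub> \<Longrightarrow> ?d b0 \<le> ?d b"
    by blast
  obtain t u p v q n where i: "index b0 = (t, u, p, v, q, n)" by (cases "index b0") auto
  have i_mem: "(t, u, p, v, q, n) \<in> basis_indices" using index(1)[OF b0(1)] i by simp
  define \<phi> where "\<phi> s = (if s = State t u p n then \<one>\<^bsub>R\<^esub> else \<zero>\<^bsub>R\<^esub>)" for s
  let ?s = "State t v q 0"
  let ?e = "\<lambda>b. evaluate \<phi> ?s (basis_word (index b))"
  have \<phi>: "\<phi> \<in> functions" by (simp add: \<phi>_def)
  have s: "?s \<in> states" using i_mem by (simp add: states_def basis_indices_def)
  have ac: "a b \<in> carrier R" if "b \<in> A" for b using that a by auto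
  have diag: "?e b0 = \<one>\<^bsub>R\<^esub>" using act_basis_word[OF i_mem] by (simp add: evaluate_def i \<phi>_def)
  have off: "a b \<otimes>\<^bsub>R\<^esub> ?e b = \<zero>\<^bsub>R\<^esub>" if b: "b \<in> A" "b \<noteq> b0" for b
  proof (cases "a b = \<zero>\<^bsub>R\<^esub>")
    case True
    then show ?thesis using evaluate_closed[OF \<phi>] by (simp add: Pi_iff)
  next
    case False
    obtain t' u' p' v' q' n' where i': "index b = (t', u', p', v', q', n')" by (cases "index b") auto
    have "index b \<noteq> index b0"
    proof
      assume "index b = index b0"
      then have "cls (basis_word (index b)) = cls (basis_word (index b0))" by simp
      then have "b = b0" unfolding index(2)[OF b(1)] index(2)[OF b0(1)] .
      with b(2) show False ..
    qed
    then have neq: "(t', u', p', v', q', n') \<noteq> (t, u, p, v, q, n)" unfolding i i' .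
    have "\<not> depth t' < depth t" using min[OF b(1) False] unfolding i i' by simp
    then have "act (basis_word (t', u', p', v', q', n')) ?s \<noteq> Some (State t u p n)"
      using act_basis_word_triangular[OF i_mem index(1)[OF b(1), unfolded i']] neq by blast
    then have "act (basis_word (index b)) ?s \<noteq> Some (State t u p n)" unfolding i' .
    then have "?e b = \<zero>\<^bsub>R\<^esub>" by (auto simp: evaluate_def \<phi>_def split: option.split)
    then show ?thesis using ac b by simp
  qed
  have "(\<Oplus>\<^bsub>L\<^esub>b\<in>A. a b \<odot>\<^bsub>L\<^esub> cls (basis_word (index b))) = (\<Oplus>\<^bsub>L\<^esub>b\<in>A. a b \<odot>\<^bsub>L\<^esub> b)"
    using index(2) ac A(2) basis_elements_closed by (intro L.M.finsum_cong') auto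
  then have "(\<Oplus>\<^bsub>R\<^esub>b\<in>A. a b \<otimes>\<^bsub>R\<^esub> ?e b) = \<zero>\<^bsub>R\<^esub>"
    using A(1) a zero \<phi> s index(1) basis_word_generator_word by (intro evaluate_relation) auto
  moreover have "(\<Oplus>\<^bsub>R\<^esub>b\<in>A. a b \<otimes>\<^bsub>R\<^esub> ?e b) = (\<Oplus>\<^bsub>R\<^esub>b\<in>A. if b = b0 then a b else \<zero>\<^bsub>R\<^esub>)"
    using off diag ac by (intro R.finsum_cong') auto
  moreover have "\<dots> = a b0"
    by (rule R.add.finprod_singleton_swap) (use A(1) a b0 in auto)
  ultimately show False using b0(2) by simp
qed

lemma module_basis_basis_elements: "module_basis R L basis_elements"
  unfolding module_basis_def
  using basis_elements_closed basis_elements_independent basis_elements_span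
  by (auto simp: linear_span_def)

end

theorem theorem19:
  fixes R :: "('k, 'm) ring_scheme"
    and G :: "('v, 'e) pre_digraph"
    and base :: "'e list set \<Rightarrow> 'v"
  assumes "cring R"
    and "fin_digraph G"
    and "cycles_disjoint G"
    and "\<forall>C\<in>cycles G. base C \<in> cycle_verts G C"
  shows "module_basis R (leavitt_path_algebra R G)
    ({path_elt R G p \<otimes>\<^bsub>leavitt_path_algebra R G\<^esub> ghost_elt R G q |p q w.
        w \<in> sinks G \<and> p \<in> paths_to G w \<and> q \<in> paths_to G w} \<union>
     {path_elt R G p \<otimes>\<^bsub>leavitt_path_algebra R G\<^esub> cycle_power R G (base C, c) n
        \<otimes>\<^bsub>leavitt_path_algebra R G\<^esub> ghost_elt R G q |p q C c n.
        C \<in> cycles G \<and> c \<in> C \<and> pre_digraph.awalk G (base C) c (base C) \<and>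
        p \<in> first_paths_to G (base C) \<and> q \<in> first_paths_to G (base C)})"
proof -
  interpret leavitt_algebra R G base
    using assms
    by (intro leavitt_algebra.intro disjoint_cycles_digraph.intro disjoint_cycles_digraph_axioms.intro)
      auto
  show ?thesis
    using module_basis_basis_elements unfolding basis_elements_eq .
qed

end
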